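(* Let $N \geq 2$ and let $\phi,\psi \in \mathrm{IA}_N(\mathbb{Z}/3\mathbb{Z})$. Suppose that there exists an integer $k \geq 1$ such that $\phi^k=\psi^k$. Then $\phi=\psi$.
   Context: $F_N$ denotes a nonabelian free group of rank $N$, $\mathrm{Out}(F_N)$ its outer automorphism group, and $\mathrm{IA}_N(\mathbb{Z}/3\mathbb{Z})$ is the kernel of the natural homomorphism $\mathrm{Out}(F_N) \to \mathrm{Aut}(H_1(F_N,\mathbb{Z}/3\mathbb{Z}))$. *)

theory Defs
  imports "HOL-Algebra.Algebra"
begin

text \<open>A letter (i, False) stands for the generator x_i, the letter (i, True) for its inverse.\<close>
type_synonym fword = "(nat \<times> bool) list"

fun fw_cancel :: "nat \<times> bool \<Rightarrow> fword \<Rightarrow> fword" where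
  "fw_cancel x [] = [x]"
| "fw_cancel x (y # ys) =
     (if fst x = fst y \<and> snd x \<noteq> snd y then ys else x # y # ys)"

definition fw_reduce :: "fword \<Rightarrow> fword" where
  "fw_reduce w = foldr fw_cancel w []"

definition fw_reduced :: "fword \<Rightarrow> bool" where
  "fw_reduced w \<longleftrightarrow>
     (\<forall>i. Suc i < length w \<longrightarrow>
        \<not> (fst (w ! i) = fst (w ! Suc i) \<and> snd (w ! i) \<noteq> snd (w ! Suc i)))"

definition free_grp :: "nat \<Rightarrow> fword monoid" where
  "free_grp N =
     \<lparr>carrier = {w. fw_reduced w \<and> (\<forall>x \<in> set w. fst x < N)},
      monoid.mult = (\<lambda>u v. fw_reduce (u @ v)),
      monoid.one = []\<rparr>"

definition Inn_free :: "nat \<Rightarrow> (fword \<Rightarrow> fword) set" where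
  "Inn_free N =
     (\<lambda>g. \<lambda>h \<in> carrier (free_grp N).
        g \<otimes>\<^bsub>free_grp N\<^esub> h \<otimes>\<^bsub>free_grp N\<^esub> inv\<^bsub>free_grp N\<^esub> g)
     ` carrier (free_grp N)"

definition Out_free :: "nat \<Rightarrow> (fword \<Rightarrow> fword) set monoid" where
  "Out_free N = AutoGroup (free_grp N) Mod Inn_free N"

text \<open>Exponent sum of the generator x_i in a word: the image of the word in H_1(F_N;Z) = Z^N.\<close>
definition expsum :: "nat \<Rightarrow> fword \<Rightarrow> int" where
  "expsum i w = sum_list (map (\<lambda>(j, b). if j = i then (if b then -1 else 1) else 0) w)"

text \<open>Kernel of Out(F_N) -> Aut(H_1(F_N; Z/3Z)): an outer class acts trivially on
  H_1(F_N;Z/3Z) = (Z/3Z)^N iff (any/every) representative sends each generator x_i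
  to a word whose exponent-sum vector is congruent to e_i mod 3.\<close>
definition IA3 :: "nat \<Rightarrow> (fword \<Rightarrow> fword) set set" where
  "IA3 N = {C \<in> carrier (Out_free N).
              \<forall>f \<in> C. \<forall>i < N. \<forall>j < N.
                 expsum j (f [(i, False)]) mod 3 = (if i = j then 1 else 0)}"

end

theory Submission
  imports Defs "HOL-Library.Function_Algebras" "HOL-Computational_Algebra.Formal_Power_Series"
begin

text \<open>The Magnus representation x_i |-> 1 + X_i embeds the free group F into the units of the ring R
  of noncommutative power series over the rationals, and an automorphism of F extends to a
  substitution endomorphism of R. Let f, g represent the two classes, so that f^k g^(-k) is
  conjugation by an element of F. We look for a unit u of R with f g^(-1)(X_i) = u X_i u^(-1),
  degree by degree. If u is correct up to degree m with error delta in degree m + 1, then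
  f^j g^(-j) is conjugate to X_i + (1 + T + ... + T^(j-1)) delta modulo degree m + 2, where T is the
  integral operator delta |-> f delta g^(-1) on families of homogeneous elements. As T is congruent to
  the identity modulo 3, the operator 1 + T + ... + T^(k-1) is injective; the inner derivations of
  degree m are stable under T and finite-dimensional, so delta is itself inner and u can be corrected.

  It remains to see that u comes from F. The element f g^(-1)(x_i) is conjugate to x_i in R; a trace
  on cyclic words shows that it is conjugate to x_i in F. Hence u is a product of an element of F and
  a power series in X_0 alone, and likewise for X_1. Comparing the two and setting X_1 = 0 shows that
  u is the image of an element of F, and conjugation by this element is f g^(-1).\<close>

section \<open>Noncommutative power series\<close>

text \<open>Since f and g need not commute, f^k g^(-k) is not a power of f g^(-1): the error it
  inherits is 1 + T + ... + T^(k-1) applied to delta, not k delta. The prime 3 matters through the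
  factor 1 + T + T^2. If T = 1 + 3 A, this is 3 (1 + 3 A + 3 A^2), and the bracket is injective on a
  lattice. Modulo 2 the corresponding factor 1 + T can vanish, as it must: inverting all generators
  gives a nontrivial outer class of order 2 that acts trivially modulo 2. Rational coefficients
  serve the step that makes delta inner: an injective endomorphism of a lattice need not be onto,
  one of a finite-dimensional vector space is. So u may a priori have denominators, and descending
  from u to an element of F needs an argument of its own; integral families remain as the lattice on
  which divisibility by 3 makes sense. Two generators enter where a series commuting with all X_i is
  shown to have no term of positive degree, and again where series in X_0 and in X_1 are
  compared.\<close>

typedef ('i, 'a) ncps = "UNIV :: ('i list \<Rightarrow> 'a) set"
  morphisms coef Abs_ncps ..

setup_lifting type_definition_ncps

lemma ncps_eqI: "(\<And>w. coef a w = coef b w) \<Longrightarrow> a = b"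
  by (simp add: coef_inject[symmetric] fun_eq_iff)

text \<open>The sum over all cuts of a word into prefix and suffix, see \<open>conv_altdef\<close>.
  Peeling off the first letter makes associativity an induction on the word and yields the product
  rule \<open>lder_mult\<close>.\<close>

fun conv :: "('i list \<Rightarrow> 'a::comm_ring_1) \<Rightarrow> ('i list \<Rightarrow> 'a) \<Rightarrow> 'i list \<Rightarrow> 'a" where
  "conv a b [] = a [] * b []"
| "conv a b (x # w) = a [] * b (x # w) + conv (\<lambda>s. a (x # s)) b w"

lemma conv_add_left: "conv (\<lambda>s. a s + a' s) b w = conv a b w + conv a' b w"
  by (induction w arbitrary: a a') (auto simp: algebra_simps)

lemma conv_scale_left: "conv (\<lambda>s. c * a s) b w = c * conv a b w"
  by (induction w arbitrary: a) (auto simp: algebra_simps)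

lemma conv_add_right: "conv a (\<lambda>s. b s + b' s) w = conv a b w + conv a b' w"
  by (induction w arbitrary: a) (auto simp: algebra_simps)

lemma conv_zero_left: "conv (\<lambda>s. 0) b w = 0"
  by (induction w) auto

lemma conv_const_left: "conv (\<lambda>s. if s = [] then c else 0) b w = c * b w"
  by (cases w) (auto simp: conv_zero_left)

lemma conv_const_right: "conv a (\<lambda>s. if s = [] then c else 0) w = c * a w"
  by (induction w arbitrary: a) auto

lemma conv_assoc: "conv (conv a b) c w = conv a (conv b c) w"
proof (induction w arbitrary: a)
  case (Cons x w)
  have "(\<lambda>s. conv a b (x # s)) = (\<lambda>s. a [] * b (x # s) + conv (\<lambda>s. a (x # s)) b s)"
    by simp
  then show ?case
    by (simp add: conv_add_left conv_scale_left Cons algebra_simps)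
qed (simp add: mult.assoc)

lemma conv_altdef: "conv a b w = (\<Sum>i\<le>length w. a (take i w) * b (drop i w))"
  by (induction w arbitrary: a) (simp_all add: sum.atMost_Suc_shift del: sum.atMost_Suc)

instantiation ncps :: (type, comm_ring_1) ring_1
begin

lift_definition zero_ncps :: "('a, 'b) ncps" is "\<lambda>_. 0" .
lift_definition one_ncps :: "('a, 'b) ncps" is "\<lambda>s. if s = [] then 1 else 0" .
lift_definition plus_ncps :: "('a, 'b) ncps \<Rightarrow> ('a, 'b) ncps \<Rightarrow> ('a, 'b) ncps" is "\<lambda>a b s. a s + b s" .
lift_definition minus_ncps :: "('a, 'b) ncps \<Rightarrow> ('a, 'b) ncps \<Rightarrow> ('a, 'b) ncps" is "\<lambda>a b s. a s - b s" .
lift_definition uminus_ncps :: "('a, 'b) ncps \<Rightarrow> ('a, 'b) ncps" is "\<lambda>a s. - a s" .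
lift_definition times_ncps :: "('a, 'b) ncps \<Rightarrow> ('a, 'b) ncps \<Rightarrow> ('a, 'b) ncps" is conv .

instance
proof
  fix a b c :: "('a, 'b) ncps"
  show "a * b * c = a * (b * c)" by transfer (simp add: fun_eq_iff conv_assoc)
  show "1 * a = a" by transfer (simp add: fun_eq_iff conv_const_left)
  show "a * 1 = a" by transfer (simp add: fun_eq_iff conv_const_right)
  show "(a + b) * c = a * c + b * c" by transfer (simp add: fun_eq_iff conv_add_left)
  show "a * (b + c) = a * b + a * c" by transfer (simp add: fun_eq_iff conv_add_right)
  show "(0 :: ('a, 'b) ncps) \<noteq> 1" by transfer (auto simp: fun_eq_iff)
qed (transfer; simp add: fun_eq_iff algebra_simps)+

end

lemma coef_zero [simp]: "coef 0 w = 0"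
  and coef_one: "coef 1 w = (if w = [] then 1 else 0)"
  and coef_add [simp]: "coef (a + b) w = coef a w + coef b w"
  and coef_diff [simp]: "coef (a - b) w = coef a w - coef b w"
  and coef_uminus [simp]: "coef (- a) w = - coef a w"
  by (transfer; simp)+

lemma coef_mult: "coef (a * b) w = (\<Sum>i\<le>length w. coef a (take i w) * coef b (drop i w))"
  by transfer (simp add: conv_altdef)

lemma coef_sum [simp]: "coef (\<Sum>i\<in>S. a i) w = (\<Sum>i\<in>S. coef (a i) w)"
  by (induction S rule: infinite_finite_induct) auto

lift_definition const :: "'a::comm_ring_1 \<Rightarrow> ('i, 'a) ncps" is "\<lambda>c s. if s = [] then c else 0" .

lemma coef_const: "coef (const c) w = (if w = [] then c else 0)"
  by transfer simp

lemma coef_const_mult [simp]: "coef (const c * a) w = c * coef a w"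
  by transfer (simp add: conv_const_left)

lemma const_commute: "a * const c = const c * a"
  by transfer (simp add: fun_eq_iff conv_const_left conv_const_right)

lemma const_one [simp]: "const 1 = 1"
  and const_zero [simp]: "const 0 = 0"
  by (transfer; simp add: fun_eq_iff)+

lemma const_mult: "const (c * d) = const c * const d"
  by (rule ncps_eqI) (simp add: coef_const)

lift_definition ncvar :: "'i \<Rightarrow> ('i, 'a::comm_ring_1) ncps" is "\<lambda>i s. if s = [i] then 1 else 0" .

lemma coef_ncvar: "coef (ncvar i) w = (if w = [i] then 1 else 0)"
  by transfer simp

text \<open>A mirrored Fox derivative: its product rule is twisted by the constant term of the left
  factor. Over a finite alphabet a series is its constant term plus the sum of X_i times
  \<open>lder i a\<close>.\<close>

lift_definition lder :: "'i \<Rightarrow> ('i, 'a) ncps \<Rightarrow> ('i, 'a) ncps" is "\<lambda>i a s. a (i # s)" .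

lemma coef_lder [simp]: "coef (lder i a) w = coef a (i # w)"
  by transfer simp

lemma coef_mult_Nil [simp]: "coef (a * b) [] = coef a [] * coef b []"
  by transfer simp

lemma coef_mult_Cons: "coef (a * b) (x # w) = coef a [] * coef b (x # w) + coef (lder x a * b) w"
  by transfer simp

lemma coef_ncvar_mult_Cons:
  fixes a :: "('a, 'b::comm_ring_1) ncps"
  shows "coef (ncvar i * a) (x # w) = (if x = i then coef a w else 0)"
proof -
  have "lder x (ncvar i) = (if x = i then 1 else 0 :: ('a, 'b) ncps)"
    by (rule ncps_eqI) (simp add: coef_ncvar coef_one)
  then show ?thesis by (simp add: coef_mult_Cons coef_ncvar)
qed

lemma coef_mult_ncvar_snoc: "coef (a * ncvar i) (w @ [x]) = (if x = i then coef a w else 0)"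
  by (induction w arbitrary: a) (simp_all add: coef_mult_Cons coef_ncvar)

lemma lder_add [simp]: "lder i (a + b) = lder i a + lder i b"
  and lder_diff [simp]: "lder i (a - b) = lder i a - lder i b"
  and lder_const [simp]: "lder i (const c) = 0"
  by (rule ncps_eqI; simp add: coef_const)+

lemma lder_ncvar: "lder i (ncvar j) = (if i = j then 1 else 0)"
  by (rule ncps_eqI) (simp add: coef_ncvar coef_one)

lemma lder_mult: "lder i (a * b) = const (coef a []) * lder i b + lder i a * b"
  by (rule ncps_eqI) (simp add: coef_mult_Cons)

section \<open>The filtration by order\<close>

definition idl :: "nat \<Rightarrow> ('i, 'a::comm_ring_1) ncps set" where
  "idl n = {a. \<forall>w. length w < n \<longrightarrow> coef a w = 0}"

lemma idl_0 [simp]: "idl 0 = UNIV"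
  by (simp add: idl_def)

lemma idl_zero [simp]: "0 \<in> idl n"
  by (simp add: idl_def)

lemma idl_mono: "a \<in> idl m \<Longrightarrow> n \<le> m \<Longrightarrow> a \<in> idl n"
  by (auto simp: idl_def)

lemma idl_add: "a \<in> idl n \<Longrightarrow> b \<in> idl n \<Longrightarrow> a + b \<in> idl n"
  and idl_diff: "a \<in> idl n \<Longrightarrow> b \<in> idl n \<Longrightarrow> a - b \<in> idl n"
  and idl_uminus: "a \<in> idl n \<Longrightarrow> - a \<in> idl n"
  by (simp_all add: idl_def)

lemma idl_sum: "(\<And>i. i \<in> S \<Longrightarrow> a i \<in> idl n) \<Longrightarrow> (\<Sum>i\<in>S. a i) \<in> idl n"
  by (simp add: idl_def)

lemma idl_mult: assumes "a \<in> idl m" "b \<in> idl n" shows "a * b \<in> idl (m + n)"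
  unfolding idl_def
proof (clarify)
  fix w :: "'a list" assume w: "length w < m + n"
  have "coef a (take i w) * coef b (drop i w) = 0" if "i \<le> length w" for i
  proof (cases "i < m")
    case True
    then show ?thesis using assms(1) that by (simp add: idl_def)
  next
    case False
    then show ?thesis using assms(2) w that by (simp add: idl_def)
  qed
  then show "coef (a * b) w = 0" by (simp add: coef_mult)
qed

lemma idl_mult_left: "b \<in> idl n \<Longrightarrow> a * b \<in> idl n"
  using idl_mult[of a 0 b n] by simp

lemma idl_mult_right: "a \<in> idl n \<Longrightarrow> a * b \<in> idl n"
  using idl_mult[of a n b 0] by simp

lemma idl_Suc_mult_left: "a \<in> idl 1 \<Longrightarrow> b \<in> idl n \<Longrightarrow> a * b \<in> idl (Suc n)"
  using idl_mult[of a 1 b n] by simp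

lemma idl_Suc_mult_right: "a \<in> idl n \<Longrightarrow> b \<in> idl 1 \<Longrightarrow> a * b \<in> idl (Suc n)"
  using idl_mult[of a n b 1] by simp

lemma idl_1_iff: "a \<in> idl 1 \<longleftrightarrow> coef a [] = 0"
  by (auto simp: idl_def)

lemma ncvar_idl: "ncvar i \<in> idl 1"
  unfolding idl_1_iff by (simp add: coef_ncvar)

lemma idl_lder: "a \<in> idl (Suc n) \<Longrightarrow> lder i a \<in> idl n"
  by (simp add: idl_def)

text \<open>The filtration is separated. Identities between series are therefore often checked
  modulo \<open>idl n\<close> for every n, by induction on n.\<close>

lemma idl_all_zero: assumes "\<And>n. a \<in> idl n" shows "a = 0"
proof (rule ncps_eqI)
  fix w show "coef a w = coef 0 w" using assms[of "Suc (length w)"] by (simp add: idl_def)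
qed

lemma idl_all_eq: "(\<And>n. a - b \<in> idl n) \<Longrightarrow> a = b"
  using idl_all_zero[of "a - b"] by simp

text \<open>Any other cut makes one of the two pieces shorter than the order of its factor, so a
  single term of the convolution survives.\<close>

lemma coef_mult_lead:
  assumes "a \<in> idl (length s)" "b \<in> idl (length t)"
  shows "coef (a * b) (s @ t) = coef a s * coef b t"
proof -
  have "coef a (take i (s @ t)) * coef b (drop i (s @ t)) =
      (if i = length s then coef a s * coef b t else 0)" if "i \<le> length (s @ t)" for i
    using assms that by (cases i "length s" rule: linorder_cases) (auto simp: idl_def)
  then show ?thesis by (simp add: coef_mult)
qed

lemma idl_power: "a \<in> idl 1 \<Longrightarrow> a ^ n \<in> idl n"
  by (induction n) (auto intro: idl_Suc_mult_left)

lemma right_inverse_exists: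
  fixes a :: "('i, 'a::comm_ring_1) ncps"
  assumes "coef a [] = 1" shows "\<exists>b. a * b = 1"
proof -
  define e where "e = 1 - a"
  have e: "e \<in> idl 1" using assms unfolding idl_1_iff by (simp add: e_def coef_one)
  \<comment> \<open>The geometric series for the inverse of 1 - e. Powers of e beyond the length of
    w vanish at w, so each coefficient is a finite sum.\<close>
  define b where "b = Abs_ncps (\<lambda>w. coef (\<Sum>n\<le>length w. e ^ n) w)"
  have cb: "coef b w = coef (\<Sum>n\<le>length w. e ^ n) w" for w
    by (simp add: b_def Abs_ncps_inverse)
  have pow0: "coef (e ^ n) w = 0" if "n > length w" for n w
    using idl_power[OF e, of n] that by (simp add: idl_def)
  have b: "b - (\<Sum>n\<le>M. e ^ n) \<in> idl (Suc M)" for M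
  proof -
    have "(\<Sum>n\<le>length w. coef (e ^ n) w) = (\<Sum>n\<le>M. coef (e ^ n) w)" if "length w \<le> M" for w
      by (rule sum.mono_neutral_left) (use that pow0 in auto)
    then show ?thesis by (simp add: idl_def cb)
  qed
  have geo: "(1 - e) * (\<Sum>n\<le>M. e ^ n) = 1 - e ^ Suc M" for M
  proof (induction M)
    case (Suc M)
    have "(1 - e) * (\<Sum>n\<le>Suc M. e ^ n) = (1 - e) * (\<Sum>n\<le>M. e ^ n) + (1 - e) * e ^ Suc M"
      by (simp only: sum.atMost_Suc distrib_left)
    also have "\<dots> = 1 - e ^ Suc (Suc M)"
      unfolding Suc by (simp add: left_diff_distrib)
    finally show ?case .
  qed simp
  have "a * b - 1 \<in> idl n" for n
  proof -
    have "a * b - 1 = a * (b - (\<Sum>j\<le>n. e ^ j)) - e ^ Suc n"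
      using geo[of n] by (simp add: e_def algebra_simps)
    moreover have "\<dots> \<in> idl (Suc n)"
      by (rule idl_diff[OF idl_mult_left[OF b] idl_power[OF e]])
    ultimately show ?thesis by (metis idl_mono le_SucI order_refl)
  qed
  then show ?thesis using idl_all_eq by blast
qed

lemma inverse_exists:
  assumes "coef a [] = 1" shows "\<exists>b. a * b = 1 \<and> b * a = 1"
proof -
  obtain b where b: "a * b = 1" using right_inverse_exists[OF assms] by blast
  then have "coef b [] = 1" using assms coef_mult_Nil[of a b] by (simp add: coef_one)
  then obtain c where c: "b * c = 1" using right_inverse_exists by blast
  then have "a = c" using b by (metis mult.assoc mult.left_neutral mult.right_neutral)
  then show ?thesis using b c by blast
qed

section \<open>Substitution\<close>

text \<open>The recursion mirrors a = a_0 + sum over i of X_i (lder i a), truncated in degree n.\<close>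

primrec psubst :: "nat \<Rightarrow> (nat \<Rightarrow> ('j, 'a::comm_ring_1) ncps) \<Rightarrow> nat \<Rightarrow> (nat, 'a) ncps \<Rightarrow> ('j, 'a) ncps" where
  "psubst N y 0 a = const (coef a [])"
| "psubst N y (Suc n) a = const (coef a []) + (\<Sum>i<N. y i * psubst N y n (lder i a))"

text \<open>When every y i has positive order, the truncation of depth n is exact in degrees up to
  n; see \<open>subst_psubst\<close>.\<close>

definition subst :: "nat \<Rightarrow> (nat \<Rightarrow> ('j, 'a::comm_ring_1) ncps) \<Rightarrow> (nat, 'a) ncps \<Rightarrow> ('j, 'a) ncps" where
  "subst N y a = Abs_ncps (\<lambda>w. coef (psubst N y (length w) a) w)"

lemma const_add: "const (c + d) = const c + const d"
  by (rule ncps_eqI) (simp add: coef_const)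

locale substitution =
  fixes N :: nat and y :: "nat \<Rightarrow> ('j, 'a::comm_ring_1) ncps"
  assumes y: "i < N \<Longrightarrow> y i \<in> idl 1"
begin

lemma y_const: "y i * (const c * b) = const c * (y i * b)"
  by (metis const_commute mult.assoc)

lemma psubst_step: "psubst N y (Suc n) a - psubst N y n a \<in> idl (Suc n)"
proof (induction n arbitrary: a)
  case 0
  then show ?case using y by (auto intro!: idl_sum idl_mult_right)
next
  case (Suc n)
  have "psubst N y (Suc (Suc n)) a - psubst N y (Suc n) a =
      (\<Sum>i<N. y i * (psubst N y (Suc n) (lder i a) - psubst N y n (lder i a)))"
    by (simp add: sum_subtractf right_diff_distrib)
  also have "\<dots> \<in> idl (Suc (Suc n))"
    using Suc y by (auto intro!: idl_sum idl_Suc_mult_left simp del: psubst.simps)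
  finally show ?case .
qed

lemma psubst_le: "psubst N y (n + d) a - psubst N y n a \<in> idl (Suc n)"
proof (induction d)
  case (Suc d)
  have "psubst N y (n + Suc d) a - psubst N y n a =
      (psubst N y (Suc (n + d)) a - psubst N y (n + d) a) + (psubst N y (n + d) a - psubst N y n a)"
    by simp
  also have "\<dots> \<in> idl (Suc n)"
    by (rule idl_add[OF idl_mono[OF psubst_step] Suc]) simp
  finally show ?case .
qed simp

lemma subst_psubst: "subst N y a - psubst N y n a \<in> idl (Suc n)"
  unfolding idl_def
proof (clarify)
  fix w :: "'j list" assume "length w < Suc n"
  then obtain d where d: "n = length w + d" using less_Suc_eq_le nat_le_iff_add by auto
  have "coef (psubst N y n a) w = coef (psubst N y (length w) a) w"
    using psubst_le[of "length w" d a] unfolding d idl_def by simp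
  then show "coef (subst N y a - psubst N y n a) w = 0"
    by (simp add: subst_def Abs_ncps_inverse)
qed

text \<open>The recursion without truncation, from which the algebraic laws below follow: an error
  in \<open>idl n\<close> for the series \<open>lder i a\<close> becomes one in
  \<open>idl (Suc n)\<close> after multiplication by y i.\<close>

lemma subst_rec: "subst N y a = const (coef a []) + (\<Sum>i<N. y i * subst N y (lder i a))"
proof (rule idl_all_eq)
  fix n
  let ?r = "const (coef a []) + (\<Sum>i<N. y i * subst N y (lder i a))"
  have "?r - psubst N y (Suc n) a = (\<Sum>i<N. y i * (subst N y (lder i a) - psubst N y n (lder i a)))"
    by (simp add: sum_subtractf right_diff_distrib)
  also have "\<dots> \<in> idl (Suc (Suc n))"
    using subst_psubst y by (auto intro!: idl_sum idl_Suc_mult_left)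
  finally have "(subst N y a - psubst N y (Suc n) a) - (?r - psubst N y (Suc n) a) \<in> idl (Suc (Suc n))"
    using subst_psubst by (blast intro: idl_diff)
  then have "subst N y a - ?r \<in> idl (Suc (Suc n))" by (simp add: algebra_simps)
  then show "subst N y a - ?r \<in> idl n" by (rule idl_mono) simp
qed

lemma coef_subst_Nil [simp]: "coef (subst N y a) [] = coef a []"
proof -
  have "coef (y i) [] = 0" if "i < N" for i using y[OF that] idl_1_iff by blast
  then show ?thesis by (subst subst_rec) (simp add: coef_const)
qed

lemma subst_add [simp]: "subst N y (a + b) = subst N y a + subst N y b"
proof (rule idl_all_eq)
  show "subst N y (a + b) - (subst N y a + subst N y b) \<in> idl n" for n
  proof (induction n arbitrary: a b)
    case (Suc n)
    have "subst N y (a + b) - (subst N y a + subst N y b) = (\<Sum>i<N. y i *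
       (subst N y (lder i a + lder i b) - (subst N y (lder i a) + subst N y (lder i b))))"
      unfolding subst_rec[of "a + b"] subst_rec[of a] subst_rec[of b]
      by (simp add: sum_subtractf sum.distrib algebra_simps const_add)
    also have "\<dots> \<in> idl (Suc n)"
      using Suc y by (auto intro!: idl_sum idl_Suc_mult_left)
    finally show ?case .
  qed simp
qed

lemma subst_const [simp]: "subst N y (const c) = const c"
proof -
  have "subst N y 0 = 0" using subst_add[of 0 0] by simp
  then show ?thesis by (subst subst_rec) (simp add: coef_const)
qed

lemma subst_zero [simp]: "subst N y 0 = 0"
  using subst_const[of 0] by simp

lemma subst_one [simp]: "subst N y 1 = 1"
  using subst_const[of 1] by simp

lemma subst_uminus [simp]: "subst N y (- a) = - subst N y a"
  using subst_add[of a "- a"] by (simp add: eq_neg_iff_add_eq_0 add.commute)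

lemma subst_diff [simp]: "subst N y (a - b) = subst N y a - subst N y b"
  using subst_add[of a "- b"] by simp

lemma subst_sum: "subst N y (\<Sum>i\<in>S. a i) = (\<Sum>i\<in>S. subst N y (a i))"
  by (induction S rule: infinite_finite_induct) auto

lemma subst_const_mult [simp]: "subst N y (const c * a) = const c * subst N y a"
proof (rule idl_all_eq)
  show "subst N y (const c * a) - const c * subst N y a \<in> idl n" for n
  proof (induction n arbitrary: a)
    case (Suc n)
    have l: "lder i (const c * a) = const c * lder i a" for i
      by (simp add: lder_mult coef_const)
    have "subst N y (const c * a) - const c * subst N y a = (\<Sum>i<N. y i *
       (subst N y (const c * lder i a) - const c * subst N y (lder i a)))"
      unfolding subst_rec[of "const c * a"] subst_rec[of a]
      by (simp add: sum_subtractf distrib_left right_diff_distrib const_mult sum_distrib_left l y_const coef_const)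
    also have "\<dots> \<in> idl (Suc n)"
      using Suc y by (auto intro!: idl_sum idl_Suc_mult_left)
    finally show ?case .
  qed simp
qed

lemma subst_mult [simp]: "subst N y (a * b) = subst N y a * subst N y b"
proof (rule idl_all_eq)
  show "subst N y (a * b) - subst N y a * subst N y b \<in> idl n" for n
  proof (induction n arbitrary: a)
    case (Suc n)
    have 1: "subst N y (a * b) = const (coef a [] * coef b []) +
        (\<Sum>i<N. y i * (const (coef a []) * subst N y (lder i b) + subst N y (lder i a * b)))"
      by (subst subst_rec) (simp add: lder_mult)
    have 2: "subst N y a * subst N y b = const (coef a []) * subst N y b +
        (\<Sum>i<N. y i * subst N y (lder i a) * subst N y b)"
      by (subst subst_rec[of a]) (simp add: distrib_right sum_distrib_right)
    have 3: "const (coef a []) * subst N y b = const (coef a [] * coef b []) +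
        (\<Sum>i<N. y i * (const (coef a []) * subst N y (lder i b)))"
      by (subst subst_rec[of b])
        (simp add: distrib_left sum_distrib_left const_mult y_const)
    have "subst N y (a * b) - subst N y a * subst N y b =
        (\<Sum>i<N. y i * (subst N y (lder i a * b) - subst N y (lder i a) * subst N y b))"
      unfolding 1 2 3 by (simp add: sum_subtractf sum.distrib distrib_left right_diff_distrib mult.assoc)
    also have "\<dots> \<in> idl (Suc n)"
      using Suc y by (auto intro!: idl_sum idl_Suc_mult_left)
    finally show ?case .
  qed simp
qed

lemma subst_ncvar [simp]: "subst N y (ncvar i) = (if i < N then y i else 0)"
proof -
  have "subst N y (ncvar i) = (\<Sum>j<N. if j = i then y j else 0)"
  proof (subst subst_rec)
    have "(\<Sum>j<N. y j * subst N y (lder j (ncvar i))) = (\<Sum>j<N. if j = i then y j else 0)"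
      by (rule sum.cong) (auto simp: lder_ncvar)
    then show "const (coef (ncvar i) []) + (\<Sum>j<N. y j * subst N y (lder j (ncvar i))) =
        (\<Sum>j<N. if j = i then y j else 0)"
      by (simp add: coef_ncvar)
  qed
  then show ?thesis by simp
qed

lemma subst_idl: "a \<in> idl n \<Longrightarrow> subst N y a \<in> idl n"
proof (induction n arbitrary: a)
  case (Suc n)
  have "coef a [] = 0" using Suc.prems by (simp add: idl_def)
  then show ?case using Suc y
    by (subst subst_rec) (auto intro!: idl_sum idl_Suc_mult_left idl_lder)
qed simp

lemma subst_comp:
  assumes "substitution N z"
  shows "subst N y (subst N z a) = subst N (\<lambda>i. subst N y (z i)) a"
proof -
  interpret z: substitution N z by fact
  interpret c: substitution N "\<lambda>i. subst N y (z i)"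
    by unfold_locales (use z.y subst_idl in auto)
  show ?thesis
  proof (rule idl_all_eq)
    show "subst N y (subst N z a) - subst N (\<lambda>i. subst N y (z i)) a \<in> idl n" for n
    proof (induction n arbitrary: a)
      case (Suc n)
      have "subst N y (subst N z a) - subst N (\<lambda>i. subst N y (z i)) a = (\<Sum>i<N. subst N y (z i) *
        (subst N y (subst N z (lder i a)) - subst N (\<lambda>i. subst N y (z i)) (lder i a)))"
        unfolding z.subst_rec[of a] c.subst_rec[of a]
        by (simp add: subst_sum sum_subtractf right_diff_distrib)
      also have "\<dots> \<in> idl (Suc n)"
        using Suc c.y by (auto intro!: idl_sum idl_Suc_mult_left)
      finally show ?case .
    qed simp
  qed
qed

text \<open>By \<open>subst_rec\<close> the difference splits into y i times the difference for
  \<open>lder i b\<close>, and the assumed error at X_i times a series. Thus conjugacy on the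
  variables passes to all values; exact conjugacy follows by letting c vary.\<close>

lemma subst_intertwine:
  assumes "substitution N x" and *: "\<And>i. i < N \<Longrightarrow> y i * u - u * x i \<in> idl c"
  shows "subst N y b * u - u * subst N x b \<in> idl c"
proof -
  interpret x: substitution N x by fact
  have "subst N y b * u - u * subst N x b \<in> idl n" if "n \<le> c" for n
    using that
  proof (induction n arbitrary: b)
    case (Suc n)
    have "subst N y b * u - u * subst N x b = (\<Sum>i<N. y i *
       (subst N y (lder i b) * u - u * subst N x (lder i b)) + (y i * u - u * x i) * subst N x (lder i b))"
      unfolding subst_rec[of b] x.subst_rec[of b]
      by (simp add: sum_subtractf sum.distrib sum_distrib_left sum_distrib_right algebra_simps
          const_commute[of u])
    also have "\<dots> \<in> idl (Suc n)"
    proof (intro idl_sum idl_add)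
      fix i assume "i \<in> {..<N}"
      then have "i < N" by simp
      then show "y i * (subst N y (lder i b) * u - u * subst N x (lder i b)) \<in> idl (Suc n)"
        and "(y i * u - u * x i) * subst N x (lder i b) \<in> idl (Suc n)"
        using Suc idl_mono[OF *] by (auto intro: idl_Suc_mult_left[OF y] idl_mult_right)
    qed
    finally show ?case .
  qed simp
  then show ?thesis by simp
qed

text \<open>First-order Taylor expansion: unless it stands alone, a perturbation of order m + 1 is
  multiplied by a further factor of positive order, so modulo order m + 2 only the linear
  coefficients of b are seen.\<close>

lemma subst_perturb:
  assumes e: "\<And>i. i < N \<Longrightarrow> e i \<in> idl (Suc m)"
  shows "subst N (\<lambda>i. y i + e i) b - subst N y b - (\<Sum>i<N. const (coef b [i]) * e i) \<in> idl (Suc (Suc m))"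
proof -
  interpret s: substitution N "\<lambda>i. y i + e i"
    by unfold_locales (intro idl_add y idl_mono[OF e], auto)
  let ?s = "subst N (\<lambda>i. y i + e i)"
  \<comment> \<open>A coarse bound of order m + 1 on the change; one more factor y i makes it
    negligible in the final estimate.\<close>
  have 1: "?s b - subst N y b \<in> idl n" if "n \<le> Suc m" for n b
    using that
  proof (induction n arbitrary: b)
    case (Suc n)
    have "?s b - subst N y b = (\<Sum>i<N. y i * (?s (lder i b) - subst N y (lder i b)) + e i * ?s (lder i b))"
      unfolding s.subst_rec[of b] subst_rec[of b]
      by (simp add: sum_subtractf sum.distrib algebra_simps)
    also have "\<dots> \<in> idl (Suc n)"
    proof (intro idl_sum idl_add)
      fix i assume "i \<in> {..<N}"
      then have "i < N" by simp
      then show "y i * (?s (lder i b) - subst N y (lder i b)) \<in> idl (Suc n)"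
        and "e i * ?s (lder i b) \<in> idl (Suc n)"
        using Suc idl_mono[OF e] by (auto intro: idl_Suc_mult_left[OF y] idl_mult_right)
    qed
    finally show ?case .
  qed simp
  have 2: "?s (lder i b) - const (coef b [i]) \<in> idl 1" for i
    unfolding idl_1_iff by (simp add: coef_const)
  have "?s b - subst N y b - (\<Sum>i<N. const (coef b [i]) * e i) =
      (\<Sum>i<N. y i * (?s (lder i b) - subst N y (lder i b)) + e i * (?s (lder i b) - const (coef b [i])))"
    unfolding s.subst_rec[of b] subst_rec[of b]
    by (simp add: sum_subtractf sum.distrib algebra_simps const_commute[of "e _"])
  also have "\<dots> \<in> idl (Suc (Suc m))"
  proof (intro idl_sum idl_add)
    fix i assume "i \<in> {..<N}"
    then have "i < N" by simp
    then show "y i * (?s (lder i b) - subst N y (lder i b)) \<in> idl (Suc (Suc m))"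
      and "e i * (?s (lder i b) - const (coef b [i])) \<in> idl (Suc (Suc m))"
      using 1 by (auto intro: idl_Suc_mult_left[OF y] idl_Suc_mult_right[OF e 2])
  qed
  finally show ?thesis .
qed

end

section \<open>Operators congruent to the identity modulo 3\<close>

text \<open>The image of a basis is independent and of the same size, so the exchange bound leaves
  nothing outside its span. This later turns injectivity of a sum of powers on a homogeneous
  component into solvability of an equation.\<close>

lemma (in vector_space) inj_endo_surj:
  assumes f: "Vector_Spaces.linear scale scale f" and B: "finite B"
    and stable: "f ` span B \<subseteq> span B" and inj: "inj_on f (span B)"
  shows "span B \<subseteq> f ` span B"
proof -
  interpret f: Vector_Spaces.linear scale scale f by fact
  interpret p: vector_space_pair scale scale by unfold_locales
  obtain C where C: "C \<subseteq> B" "independent C" "B \<subseteq> span C"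
    by (rule maximal_independent_subset)
  have span: "span C = span B"
    using C by (meson span_mono span_minimal subspace_span subset_antisym)
  have fC: "finite C" using C B finite_subset by blast
  have indep: "independent (f ` C)"
    by (rule p.linear_independent_injective_image[OF f C(2)]) (use inj span in auto)
  have card: "card (f ` C) = card C"
    by (rule card_image) (meson inj inj_on_subset C span_superset order_trans)
  have sub: "f ` C \<subseteq> span C"
    using stable span C span_superset by blast
  have "C \<subseteq> span (f ` C)"
  proof (rule ccontr)
    assume "\<not> C \<subseteq> span (f ` C)"
    then obtain b where b: "b \<in> C" "b \<notin> span (f ` C)" by blast
    then have "independent (insert b (f ` C))" using indep by (simp add: independent_insertI)
    moreover have "insert b (f ` C) \<subseteq> span C" using b sub span_base by blast
    ultimately have "card (insert b (f ` C)) \<le> card C" using independent_span_bound fC by blast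
    moreover have "b \<notin> f ` C" using b span_base by blast
    ultimately show False using card fC by simp
  qed
  then have "span C \<subseteq> span (f ` C)" by (simp add: span_minimal)
  also have "\<dots> = f ` span C" by (rule f.span_image)
  finally show ?thesis using span by simp
qed

text \<open>Multiplication by 3 is spelled \<open>y + y + y\<close> because the type is merely an
  abelian group. By \<open>separated\<close>, a subset of L whose elements are triples of its own
  elements contains at most 0; this abstracts the fact that a nonzero integer is not divisible by
  all powers of 3.\<close>

locale unipotent_mod_3 =
  fixes L :: "'v::ab_group_add set" and T :: "'v \<Rightarrow> 'v"
  assumes zero_mem: "0 \<in> L"
    and diff_mem: "x \<in> L \<Longrightarrow> y \<in> L \<Longrightarrow> x - y \<in> L"
    and T_diff: "T (x - y) = T x - T y"
    and T_mod_3: "x \<in> L \<Longrightarrow> \<exists>y\<in>L. T x = x + (y + y + y)"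
    and torsion_free: "y + y + y = 0 \<Longrightarrow> y = 0"
    and separated: "S \<subseteq> L \<Longrightarrow> (\<And>x. x \<in> S \<Longrightarrow> \<exists>y\<in>S. x = y + y + y) \<Longrightarrow> x \<in> S \<Longrightarrow> x = 0"
begin

lemma uminus_mem: "x \<in> L \<Longrightarrow> - x \<in> L"
  using diff_mem[OF zero_mem, of x] by simp

lemma add_mem: "x \<in> L \<Longrightarrow> y \<in> L \<Longrightarrow> x + y \<in> L"
  using diff_mem[of x "- y"] uminus_mem by simp

lemma sum_mem: "(\<And>i. i \<in> S \<Longrightarrow> a i \<in> L) \<Longrightarrow> sum a S \<in> L"
  by (induction S rule: infinite_finite_induct) (auto simp: zero_mem add_mem)

lemma T_mem: "x \<in> L \<Longrightarrow> T x \<in> L"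
  using T_mod_3[of x] add_mem by metis

lemma T_zero: "T 0 = 0"
  using T_diff[of 0 0] by simp

lemma T_add: "T (x + y) = T x + T y"
  using T_diff[of x "- y"] T_diff[of 0 y] T_zero by simp

lemma funpow_mod_3: "x \<in> L \<Longrightarrow> \<exists>y\<in>L. (T ^^ n) x = x + (y + y + y)"
proof (induction n)
  case 0
  then show ?case using zero_mem by force
next
  case (Suc n)
  then obtain y where y: "y \<in> L" "(T ^^ n) x = x + (y + y + y)" by blast
  obtain z where z: "z \<in> L" "T x = x + (z + z + z)" using T_mod_3 Suc by blast
  have "(T ^^ Suc n) x = x + ((z + T y) + (z + T y) + (z + T y))"
    using y z by (simp add: T_add algebra_simps)
  then show ?case using y z T_mem add_mem by blast
qed

lemma funpow_diff: "(T ^^ n) (x - y) = (T ^^ n) x - (T ^^ n) y"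
  by (induction n) (auto simp: T_diff)

lemma unipotent_funpow: "unipotent_mod_3 L (T ^^ n)"
proof
  show "\<exists>y\<in>L. (T ^^ n) x = x + (y + y + y)" if "x \<in> L" for x using that by (rule funpow_mod_3)
  show "x = 0" if "S \<subseteq> L" "\<And>x. x \<in> S \<Longrightarrow> \<exists>y\<in>S. x = y + y + y" "x \<in> S" for S x
    using that by (rule separated)
qed (fact zero_mem diff_mem funpow_diff torsion_free)+

lemma triple_uminus:
  fixes x y :: 'v
  shows "x + (y + y + y) = 0 \<Longrightarrow> x = - y + - y + - y"
  using eq_neg_iff_add_eq_0[of x "y + y + y"] by simp

lemma triple_residue_1:
  fixes x q w :: 'v
  assumes "q + q + q + x + (w + w + w) = 0"
  shows "x = - (w + q) + - (w + q) + - (w + q)"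
proof (rule triple_uminus)
  have "x + (w + q + (w + q) + (w + q)) = q + q + q + x + (w + w + w)" by (simp add: add_ac)
  then show "x + (w + q + (w + q) + (w + q)) = 0" using assms by simp
qed

lemma triple_residue_2:
  fixes x q w :: 'v
  assumes "q + q + q + x + x + (w + w + w) = 0"
  shows "x = (x + w + q) + (x + w + q) + (x + w + q)"
proof -
  have "(x + w + q) + (x + w + q) + (x + w + q) = x + (q + q + q + x + x + (w + w + w))"
    by (simp add: add_ac)
  then show ?thesis using assms by simp
qed

text \<open>If a kernel element is a triple of y, then three times P y is 0, and torsion-freeness
  puts y into the kernel as well. So the kernel is divisible by 3 within itself and
  \<open>separated\<close> applies. Injectivity is thereby reduced to showing that kernel elements
  are triples.\<close>

lemma kernel_zero:
  fixes P :: "'v \<Rightarrow> 'v"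
  assumes P_diff: "P 0 = 0" "\<And>y. P (y + y + y) = P y + P y + P y"
    and "\<And>x. x \<in> L \<Longrightarrow> P x = 0 \<Longrightarrow> \<exists>y\<in>L. x = y + y + y"
    and "x \<in> L" "P x = 0"
  shows "x = 0"
proof (rule separated[of "{x \<in> L. P x = 0}"])
  fix x assume "x \<in> {x \<in> L. P x = 0}"
  then obtain y where y: "y \<in> L" "x = y + y + y" using assms(3) by blast
  with \<open>x \<in> _\<close> have "P y = 0" using torsion_free[of "P y"] P_diff by simp
  with y show "\<exists>y\<in>{x \<in> L. P x = 0}. x = y + y + y" by blast
qed (use assms in auto)

text \<open>With T x = x + 3 y and T y = y + 3 z the sum is 3 (x + 3 y + 3 z). After the outer 3 is
  cancelled, x is still seen to be a triple.\<close>

lemma kernel_3: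
  assumes "x \<in> L" "x + T x + T (T x) = 0"
  shows "x = 0"
proof (rule kernel_zero[where P = "\<lambda>x. x + T x + T (T x)"])
  fix x assume x: "x \<in> L" "x + T x + T (T x) = 0"
  obtain y where y: "y \<in> L" "T x = x + (y + y + y)" using T_mod_3 x by blast
  obtain z where z: "z \<in> L" "T y = y + (z + z + z)" using T_mod_3 y by blast
  have "x + T x + T (T x) = x + x + x + (y + y + y) + (y + y + y) + (y + y + y) + (z + z + z) + (z + z + z) + (z + z + z)"
    using y z by (simp add: T_add algebra_simps)
  then have "(x + (y + y + y) + (z + z + z)) + (x + (y + y + y) + (z + z + z)) + (x + (y + y + y) + (z + z + z)) = 0"
    using x by (simp add: add_ac)
  then have "x + (y + y + y) + (z + z + z) = 0" by (rule torsion_free)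
  then have "x + ((y + z) + (y + z) + (y + z)) = 0" by (simp add: add_ac)
  then have "x = - (y + z) + - (y + z) + - (y + z)" by (rule triple_uminus)
  moreover have "- (y + z) \<in> L" using y z uminus_mem add_mem by blast
  ultimately show "\<exists>y\<in>L. x = y + y + y" by blast
qed (use assms in \<open>auto simp: T_add T_zero algebra_simps\<close>)

text \<open>Modulo 3 L the sum is k x, and k is invertible modulo 3; its two possible residues are
  handled by \<open>triple_residue_1\<close> and \<open>triple_residue_2\<close>.\<close>

lemma kernel_not_dvd_3:
  assumes k: "\<not> 3 dvd k" and x: "x \<in> L" "(\<Sum>j<k. (T ^^ j) x) = 0"
  shows "x = 0"
proof (rule kernel_zero[where P = "\<lambda>x. \<Sum>j<k. (T ^^ j) x"])
  fix x assume x: "x \<in> L" "(\<Sum>j<k. (T ^^ j) x) = 0"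
  have "\<forall>j. \<exists>y. y \<in> L \<and> (T ^^ j) x = x + (y + y + y)" using funpow_mod_3[OF x(1)] by blast
  then obtain w where w: "w j \<in> L" "(T ^^ j) x = x + (w j + w j + w j)" for j by metis
  let ?w = "\<Sum>j<k. w j"
  have "(\<Sum>j<k. (T ^^ j) x) = (\<Sum>j<k. x) + (?w + ?w + ?w)"
    unfolding w(2) by (simp only: sum.distrib)
  then have sum0: "(\<Sum>j<k. x) + (?w + ?w + ?w) = 0" using x by simp
  have wL: "?w \<in> L" by (intro sum_mem w)
  define q where "q = k div 3"
  let ?q = "\<Sum>j<q. x"
  have qL: "?q \<in> L" by (intro sum_mem x)
  have q3: "(\<Sum>j<q * 3. x) = ?q + ?q + ?q"
    by (induction q) (simp_all add: algebra_simps numeral_3_eq_3)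
  have "k = Suc (q * 3) \<or> k = Suc (Suc (q * 3))"
    using k unfolding q_def by presburger
  then show "\<exists>y\<in>L. x = y + y + y"
  proof
    assume "k = Suc (q * 3)"
    then have eq: "(\<Sum>j<k. x) = ?q + ?q + ?q + x" by (simp add: q3)
    have "x = - (?w + ?q) + - (?w + ?q) + - (?w + ?q)"
      by (rule triple_residue_1[OF sum0[unfolded eq]])
    then show ?thesis using wL qL uminus_mem add_mem by blast
  next
    assume "k = Suc (Suc (q * 3))"
    then have eq: "(\<Sum>j<k. x) = ?q + ?q + ?q + x + x" by (simp add: q3)
    have "x = (x + ?w + ?q) + (x + ?w + ?q) + (x + ?w + ?q)"
      by (rule triple_residue_2[OF sum0[unfolded eq]])
    then show ?thesis using wL qL x add_mem by blast
  qed
next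
  show "(\<Sum>j<k. (T ^^ j) (y + y + y)) = (\<Sum>j<k. (T ^^ j) y) + (\<Sum>j<k. (T ^^ j) y) + (\<Sum>j<k. (T ^^ j) y)" for y
  proof -
    have "(T ^^ j) (a + b) = (T ^^ j) a + (T ^^ j) b" for j a b
      by (induction j) (auto simp: T_add)
    then show ?thesis by (simp add: sum.distrib)
  qed
  show "(\<Sum>j<k. (T ^^ j) 0) = 0"
  proof -
    have "(T ^^ j) 0 = 0" for j by (induction j) (auto simp: T_zero)
    then show ?thesis by simp
  qed
qed (use x in auto)

end

text \<open>Strong induction on k with T varying: 1 + T + ... + T^(3n-1) is 1 + T + T^2 times the
  sum of the first n powers of T^3, and T^3 satisfies the same axioms.\<close>

theorem unipotent_mod_3_kernel:
  assumes "unipotent_mod_3 L T" "k > 0" "x \<in> L" "(\<Sum>j<k. (T ^^ j) x) = 0"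
  shows "x = 0"
  using assms
proof (induction k arbitrary: T rule: less_induct)
  case (less k)
  interpret unipotent_mod_3 L T by fact
  show ?case
  proof (cases "3 dvd k")
    case False
    then show ?thesis using less.prems kernel_not_dvd_3 by blast
  next
    case True
    then obtain n where n: "k = n * 3" by (metis dvd_div_mult_self)
    define z where "z = (\<Sum>j<n. ((T ^^ 3) ^^ j) x)"
    interpret T3: unipotent_mod_3 L "T ^^ 3" by (rule unipotent_funpow)
    have "(\<Sum>j<m * 3. (T ^^ j) x) = (\<Sum>j<m. ((T ^^ 3) ^^ j) x) + T (\<Sum>j<m. ((T ^^ 3) ^^ j) x)
        + T (T (\<Sum>j<m. ((T ^^ 3) ^^ j) x))" for m
    proof (induction m)
      case (Suc m)
      have *: "(T ^^ (m * 3)) x = ((T ^^ 3) ^^ m) x" by (simp add: funpow_mult mult.commute)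
      have "(\<Sum>j<Suc m * 3. (T ^^ j) x) = (\<Sum>j<m * 3. (T ^^ j) x) + (T ^^ (m * 3)) x
          + T ((T ^^ (m * 3)) x) + T (T ((T ^^ (m * 3)) x))"
        by (simp add: numeral_3_eq_3 add.assoc)
      also have "\<dots> = (\<Sum>j<Suc m. ((T ^^ 3) ^^ j) x) + T (\<Sum>j<Suc m. ((T ^^ 3) ^^ j) x)
        + T (T (\<Sum>j<Suc m. ((T ^^ 3) ^^ j) x))"
        unfolding Suc * by (simp add: T_add add_ac)
      finally show ?case .
    qed (simp add: T_zero)
    then have "z + T z + T (T z) = 0" using less.prems(4) by (simp add: n z_def)
    moreover have "z \<in> L"
      unfolding z_def
    proof (rule sum_mem)
      show "((T ^^ 3) ^^ j) x \<in> L" for j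
        using less.prems(3) T3.T_mem by (induction j) auto
    qed
    ultimately have "z = 0" using kernel_3 by blast
    then show ?thesis
      using less.IH[of n "T ^^ 3"] less.prems n T3.unipotent_mod_3_axioms unfolding z_def by auto
  qed
qed

section \<open>Congruences and homogeneous parts\<close>

lemma psubst_cong: "(\<And>i. i < N \<Longrightarrow> y i = z i) \<Longrightarrow> psubst N y n a = psubst N z n a"
  by (induction n arbitrary: a) auto

lemma subst_cong: "(\<And>i. i < N \<Longrightarrow> y i = z i) \<Longrightarrow> subst N y a = subst N z a"
  unfolding subst_def using psubst_cong[of N y z] by simp

interpretation ncvar_subst: substitution N "ncvar :: nat \<Rightarrow> (nat, 'a::comm_ring_1) ncps" for N
  by unfold_locales (rule ncvar_idl)

text \<open>Words range over all naturals, so substituting the first N variables for themselves is a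
  projection. Below, \<open>subst N ncvar a = a\<close> is the way to say that a involves only these
  variables.\<close>

lemma coef_subst_ncvar:
  "coef (subst N ncvar a) w = (if set w \<subseteq> {..<N} then coef a w else 0)"
proof (induction w arbitrary: a)
  case (Cons x w)
  have "coef (subst N ncvar a) (x # w) = (\<Sum>i<N. if x = i then coef (subst N ncvar (lder i a)) w else 0)"
    by (subst ncvar_subst.subst_rec) (simp add: coef_const coef_ncvar_mult_Cons)
  then show ?case using Cons by auto
qed simp

lemma funpow_subst_compose:
  fixes y :: "nat \<Rightarrow> (nat, 'a::comm_ring_1) ncps"
  assumes "substitution N y" "substitution N x"
  shows "substitution N (\<lambda>i. (subst N y ^^ n) (x i))"
    and "(subst N y ^^ n) (subst N x a) = subst N (\<lambda>i. (subst N y ^^ n) (x i)) a"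
proof -
  interpret y: substitution N y by fact
  show *: "substitution N (\<lambda>i. (subst N y ^^ n) (x i))" for n
  proof
    show "(subst N y ^^ n) (x i) \<in> idl 1" if "i < N" for i
      using substitution.y[OF assms(2) that] by (induction n) (simp_all add: y.subst_idl)
  qed
  show "(subst N y ^^ n) (subst N x a) = subst N (\<lambda>i. (subst N y ^^ n) (x i)) a"
    by (induction n) (simp_all add: y.subst_comp[OF *])
qed

section \<open>Congruence up to a given order\<close>

definition idl_cong :: "nat \<Rightarrow> ('i, 'a::comm_ring_1) ncps \<Rightarrow> ('i, 'a) ncps \<Rightarrow> bool" where
  "idl_cong n a b \<longleftrightarrow> a - b \<in> idl n"

lemma idl_cong_refl [simp]: "idl_cong n a a"
  by (simp add: idl_cong_def)

lemma idl_cong_sym: "idl_cong n a b \<Longrightarrow> idl_cong n b a"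
  unfolding idl_cong_def using idl_uminus[of "a - b"] by simp

lemma idl_cong_trans [trans]: "idl_cong n a b \<Longrightarrow> idl_cong n b c \<Longrightarrow> idl_cong n a c"
  unfolding idl_cong_def using idl_add[of "a - b" n "b - c"] by simp

lemma idl_cong_mono: "idl_cong m a b \<Longrightarrow> n \<le> m \<Longrightarrow> idl_cong n a b"
  unfolding idl_cong_def by (rule idl_mono)

lemma idl_cong_add: "idl_cong n a b \<Longrightarrow> idl_cong n c d \<Longrightarrow> idl_cong n (a + c) (b + d)"
  unfolding idl_cong_def using idl_add[of "a - b" n "c - d"] by (simp add: algebra_simps)

lemma idl_cong_diff: "idl_cong n a b \<Longrightarrow> idl_cong n c d \<Longrightarrow> idl_cong n (a - c) (b - d)"
  unfolding idl_cong_def using idl_diff[of "a - b" n "c - d"] by (simp add: algebra_simps)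

lemma idl_cong_mult: "idl_cong n a b \<Longrightarrow> idl_cong n c d \<Longrightarrow> idl_cong n (a * c) (b * d)"
proof -
  assume "idl_cong n a b" "idl_cong n c d"
  then have "(a - b) * c + b * (c - d) \<in> idl n"
    unfolding idl_cong_def by (intro idl_add idl_mult_left idl_mult_right)
  then show ?thesis unfolding idl_cong_def by (simp add: algebra_simps)
qed

lemmas idl_cong_mult_left = idl_cong_mult[OF idl_cong_refl]
lemmas idl_cong_mult_right = idl_cong_mult[OF _ idl_cong_refl]

lemma idl_cong_idl: "idl_cong n a b \<Longrightarrow> b \<in> idl n \<Longrightarrow> a \<in> idl n"
  unfolding idl_cong_def using idl_add[of "a - b" n b] by simp

text \<open>A unit with constant term 1 leaves leading terms unchanged, so conjugators can be moved
  past an error of top degree.\<close>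

lemma idl_cong_commute_unit:
  assumes "a \<in> idl m" "coef u [] = 1"
  shows "idl_cong (Suc m) (a * u) a" "idl_cong (Suc m) (u * a) a"
proof -
  have "u - 1 \<in> idl 1" using assms unfolding idl_1_iff by (simp add: coef_one)
  then have "a * (u - 1) \<in> idl (Suc m)" "(u - 1) * a \<in> idl (Suc m)"
    using assms by (auto intro: idl_Suc_mult_left idl_Suc_mult_right)
  then show "idl_cong (Suc m) (a * u) a" "idl_cong (Suc m) (u * a) a"
    unfolding idl_cong_def by (simp_all add: algebra_simps)
qed

lemma (in substitution) subst_idl_cong: "idl_cong n a b \<Longrightarrow> idl_cong n (subst N y a) (subst N y b)"
  unfolding idl_cong_def using subst_idl[of "a - b" n] by simp

section \<open>Homogeneous components\<close>

lift_definition hpart :: "nat \<Rightarrow> ('i, 'a::comm_ring_1) ncps \<Rightarrow> ('i, 'a) ncps"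
  is "\<lambda>d a w. if length w = d then a w else 0" .

lemma coef_hpart: "coef (hpart d a) w = (if length w = d then coef a w else 0)"
  by transfer simp

lemma hpart_add: "hpart d (a + b) = hpart d a + hpart d b"
  and hpart_diff: "hpart d (a - b) = hpart d a - hpart d b"
  and hpart_const_mult: "hpart d (const c * a) = const c * hpart d a"
  and hpart_zero: "hpart d 0 = 0"
  by (rule ncps_eqI; simp add: coef_hpart)+

lemma idl_cong_hpart: "a \<in> idl d \<Longrightarrow> idl_cong (Suc d) a (hpart d a)"
  by (auto simp: idl_cong_def idl_def coef_hpart)

lemma hpart_idl_cong: "idl_cong (Suc d) a b \<Longrightarrow> hpart d a = hpart d b"
  by (rule ncps_eqI) (simp add: idl_cong_def idl_def coef_hpart)

text \<open>Bounding the alphabet as well as fixing the degree makes this space finite-dimensional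
  over a field.\<close>

definition homog :: "nat \<Rightarrow> nat \<Rightarrow> (nat, 'a::comm_ring_1) ncps set" where
  "homog N d = {a. \<forall>w. coef a w \<noteq> 0 \<longrightarrow> length w = d \<and> set w \<subseteq> {..<N}}"

lemma homog_zero: "0 \<in> homog N d"
  by (simp add: homog_def)

lemma homog_diff: "a \<in> homog N d \<Longrightarrow> b \<in> homog N d \<Longrightarrow> a - b \<in> homog N d"
  unfolding homog_def by simp (metis diff_self)

lemma homog_uminus: "a \<in> homog N d \<Longrightarrow> - a \<in> homog N d"
  by (simp add: homog_def)

lemma homog_add: "a \<in> homog N d \<Longrightarrow> b \<in> homog N d \<Longrightarrow> a + b \<in> homog N d"
  using homog_diff[OF _ homog_uminus, of a N d b] by simp

lemma homog_const_mult: "a \<in> homog N d \<Longrightarrow> const c * a \<in> homog N d"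
  unfolding homog_def by simp (metis mult_zero_right)

lemma homog_idl: "a \<in> homog N d \<Longrightarrow> a \<in> idl d"
  by (auto simp: homog_def idl_def)

lemma homog_hpart: "a \<in> homog N d \<Longrightarrow> hpart d a = a"
  by (rule ncps_eqI) (auto simp: homog_def coef_hpart)

lemma homog_idl_Suc: "a \<in> homog N d \<Longrightarrow> a \<in> idl (Suc d) \<Longrightarrow> a = 0"
  by (rule ncps_eqI) (auto simp: homog_def idl_def)

lemma homog_idl_cong: "a \<in> homog N d \<Longrightarrow> b \<in> homog N d \<Longrightarrow> idl_cong (Suc d) a b \<Longrightarrow> a = b"
  using homog_idl_Suc[of "a - b" N d] by (simp add: homog_diff idl_cong_def)

lemma hpart_homog: "subst N ncvar a = a \<Longrightarrow> hpart d a \<in> homog N d"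
  unfolding homog_def mem_Collect_eq coef_hpart by (metis coef_subst_ncvar)

lemma homog_supported: "a \<in> homog N d \<Longrightarrow> subst N ncvar a = a"
  by (rule ncps_eqI) (auto simp: coef_subst_ncvar homog_def)

lemma homog_commutator:
  "a \<in> homog N d \<Longrightarrow> i < N \<Longrightarrow> a * ncvar i - ncvar i * a \<in> homog N (Suc d)"
proof -
  assume a: "a \<in> homog N d" and i: "i < N"
  have "subst N ncvar (a * ncvar i - ncvar i * a) = a * ncvar i - ncvar i * a"
    using homog_supported[OF a] i by simp
  then have 1: "hpart (Suc d) (a * ncvar i - ncvar i * a) \<in> homog N (Suc d)" by (rule hpart_homog)
  have "hpart (Suc d) (a * ncvar i - ncvar i * a) = a * ncvar i - ncvar i * a"
  proof (rule ncps_eqI)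
    fix w
    have "coef (a * ncvar i) w = 0 \<and> coef (ncvar i * a) w = 0" if "length w \<noteq> Suc d"
    proof (cases w rule: rev_cases)
      case (snoc v x)
      then have "coef (a * ncvar i) w = 0"
        using a that by (auto simp: coef_mult_ncvar_snoc homog_def)
      moreover have "coef (ncvar i * a) w = 0"
        using a that by (cases w) (auto simp: coef_ncvar_mult_Cons homog_def coef_ncvar)
      ultimately show ?thesis by simp
    qed (simp add: coef_ncvar)
    then show "coef (hpart (Suc d) (a * ncvar i - ncvar i * a)) w = coef (a * ncvar i - ncvar i * a) w"
      by (auto simp: coef_hpart)
  qed
  with 1 show ?thesis by simp
qed

text \<open>A coefficient of the commutator comes from only one of the two products once the variable
  differs from the first letter; this is where two generators are needed.\<close>

lemma centralizer_lead:
  fixes a :: "(nat, 'a::comm_ring_1) ncps"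
  assumes N: "2 \<le> N" and a: "a \<in> idl d" "0 < d"
    and comm: "\<And>i. i < N \<Longrightarrow> a * ncvar i - ncvar i * a \<in> idl (Suc (Suc d))"
  shows "a \<in> idl (Suc d)"
  unfolding idl_def
proof (clarify)
  fix t :: "nat list" assume t: "length t < Suc d"
  show "coef a t = 0"
  proof (cases "length t < d")
    case True
    then show ?thesis using a by (simp add: idl_def)
  next
    case False
    then obtain x s where s: "t = x # s" using a by (cases t) auto
    define i :: nat where "i = (if x = 0 then 1 else 0)"
    have i: "i < N" "x \<noteq> i" using N by (auto simp: i_def)
    have "coef (a * ncvar i - ncvar i * a) (t @ [i]) = 0"
      using comm[OF i(1)] t unfolding idl_def by simp
    moreover have "coef (ncvar i * a) (t @ [i]) = 0"
      using i by (simp add: s coef_ncvar_mult_Cons)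
    ultimately show ?thesis by (simp add: coef_mult_ncvar_snoc)
  qed
qed

section \<open>The twisted operator\<close>

type_synonym series = "(nat, rat) ncps"

definition cong3 :: "rat \<Rightarrow> rat \<Rightarrow> bool" where
  "cong3 p q \<longleftrightarrow> (\<exists>n::int. p - q = 3 * of_int n)"

lemma cong3_add: "cong3 p q \<Longrightarrow> cong3 r s \<Longrightarrow> cong3 (p + r) (q + s)"
proof -
  assume "cong3 p q" "cong3 r s"
  then obtain m n where "p - q = 3 * of_int m" "r - s = 3 * of_int n" unfolding cong3_def by blast
  then have "(p + r) - (q + s) = 3 * of_int (m + n)" by simp
  then show ?thesis unfolding cong3_def by blast
qed

lemma cong3_refl: "cong3 p p"
  unfolding cong3_def by (rule exI[of _ 0]) simp

lemma cong3_sum: "(\<And>i. i \<in> S \<Longrightarrow> cong3 (p i) (q i)) \<Longrightarrow> cong3 (sum p S) (sum q S)"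
  by (induction S rule: infinite_finite_induct) (auto simp: cong3_add cong3_refl)

text \<open>Integrality of q and s makes p and r integers too; congruence modulo 3 between arbitrary
  rationals is not multiplicative.\<close>

lemma cong3_mult:
  assumes "cong3 p q" "cong3 r s" "q \<in> \<int>" "s \<in> \<int>" shows "cong3 (p * r) (q * s)"
proof -
  obtain m n where mn: "p = q + 3 * of_int m" "r = s + 3 * of_int n"
    using assms unfolding cong3_def by (metis add.commute diff_add_cancel)
  obtain a b where ab: "q = of_int a" "s = of_int b" using assms by (auto elim!: Ints_cases)
  have "p * r - q * s = 3 * of_int (a * n + m * b + 3 * m * n)"
    unfolding mn ab by (simp add: algebra_simps)
  then show ?thesis unfolding cong3_def by blast
qed

lemma common_denominator:
  assumes "finite (Q :: rat set)" shows "\<exists>D::int. D > 0 \<and> (\<forall>q\<in>Q. of_int D * q \<in> \<int>)"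
  using assms
proof (induction Q rule: finite_induct)
  case empty
  show ?case by (rule exI[of _ 1]) simp
next
  case (insert x Q)
  then obtain D :: int where D: "D > 0" "\<forall>q\<in>Q. of_int D * q \<in> \<int>" by blast
  obtain a b where ab: "quotient_of x = (a, b)" by force
  then have b: "b > 0" "x = of_int a / of_int b"
    using quotient_of_denom_pos quotient_of_div by blast+
  have "of_int (D * b) * x = of_int (D * a)" using b by simp
  moreover have "of_int (D * b) * q \<in> \<int>" if "q \<in> Q" for q
  proof -
    have "of_int (D * b) * q = of_int b * (of_int D * q)" by simp
    then show ?thesis using D that by (metis Ints_mult Ints_of_int)
  qed
  ultimately show ?case using D b by (intro exI[of _ "D * b"]) auto
qed

lemma sum_fun_apply: "(\<Sum>s\<in>S. f s) x = (\<Sum>s\<in>S. f s x)"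
  by (induction S rule: infinite_finite_induct) auto

text \<open>The linear part of y plays the role of the matrix on homology. The congruence forces its
  entries to be integers, while the higher coefficients may be arbitrary rationals.\<close>

locale substitution_mod_3 = substitution N y for N :: nat and y :: "nat \<Rightarrow> series" +
  assumes y_supported: "i < N \<Longrightarrow> subst N ncvar (y i) = y i"
    and y_mod_3: "i < N \<Longrightarrow> cong3 (coef (y i) [j]) (if i = j then 1 else 0)"
begin

lemma subst_supported: "subst N ncvar (subst N y a) = subst N y a"
proof -
  have "subst N ncvar (subst N y a) = subst N (\<lambda>i. subst N ncvar (y i)) a"
    by (rule ncvar_subst.subst_comp) (fact substitution_axioms)
  also have "\<dots> = subst N y a" by (rule subst_cong) (rule y_supported)
  finally show ?thesis .
qed

text \<open>On the lowest degree d substitution acts through the d-th tensor power of the linear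
  part of y, and a tensor power of a matrix congruent to the identity modulo 3 is again congruent to
  the identity.\<close>

lemma coef_subst_mod_3:
  assumes "a \<in> idl (length t)" "\<And>w. length w = length t \<Longrightarrow> coef a w \<in> \<int>"
    and "\<And>w. length w = length t \<Longrightarrow> \<not> set w \<subseteq> {..<N} \<Longrightarrow> coef a w = 0"
  shows "cong3 (coef (subst N y a) t) (coef a t)"
  using assms
proof (induction t arbitrary: a)
  case (Cons x t)
  have l: "lder i a \<in> idl (length t)" for i
    using Cons.prems(1) idl_lder[of a "length t" i] by simp
  have "coef (subst N y a) (x # t) = (\<Sum>i<N. coef (y i * subst N y (lder i a)) ([x] @ t))"
    by (subst subst_rec) (simp add: coef_const)
  also have "\<dots> = (\<Sum>i<N. coef (y i) [x] * coef (subst N y (lder i a)) t)"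
  proof (intro sum.cong refl coef_mult_lead)
    show "y i \<in> idl (length [x])" if "i \<in> {..<N}" for i
      using that y[of i] by simp
    show "subst N y (lder i a) \<in> idl (length t)" for i by (rule subst_idl[OF l])
  qed
  finally have 1: "coef (subst N y a) (x # t) = (\<Sum>i<N. coef (y i) [x] * coef (subst N y (lder i a)) t)" .
  have "cong3 (\<Sum>i<N. coef (y i) [x] * coef (subst N y (lder i a)) t)
     (\<Sum>i<N. (if i = x then 1 else 0) * coef (lder i a) t)"
  proof (intro cong3_sum cong3_mult Cons.IH)
    fix i assume i: "i \<in> {..<N}"
    show "cong3 (coef (y i) [x]) (if i = x then 1 else 0)" using i y_mod_3 by simp
    show "coef (lder i a) w = 0" if "length w = length t" "\<not> set w \<subseteq> {..<N}" for w
      using Cons.prems(3)[of "i # w"] that by simp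
  qed (use l Cons.prems(2) in auto)
  also have "(\<Sum>i<N. (if i = x then 1 else 0) * coef (lder i a) t) = (\<Sum>i<N. if i = x then coef a (x # t) else 0)"
    by (intro sum.cong) auto
  also have "\<dots> = coef a (x # t)"
    using Cons.prems(3)[of "x # t"] by auto
  finally show ?case unfolding 1 .
qed (simp add: cong3_refl)

end

text \<open>In the application F extends f and G extends the inverse of g, so that F after G extends
  f g^(-1).\<close>

locale twisted_pair = F: substitution_mod_3 N y + G: substitution_mod_3 N z
  for N :: nat and y z :: "nat \<Rightarrow> series"
begin

abbreviation "F \<equiv> subst N y"
abbreviation "G \<equiv> subst N z"

text \<open>Fixing the value 0 at indices from N on lets families be compared as functions.\<close>

definition Vec :: "nat \<Rightarrow> (nat \<Rightarrow> series) set" where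
  "Vec d = {e. \<forall>i. (i < N \<longrightarrow> e i \<in> homog N d) \<and> (\<not> i < N \<longrightarrow> e i = 0)}"

definition Lat :: "nat \<Rightarrow> (nat \<Rightarrow> series) set" where
  "Lat d = {e \<in> Vec d. \<forall>i w. coef (e i) w \<in> \<int>}"

text \<open>The operator T on leading terms: perturbing each X_j by e j changes G (X_i), in leading
  degree, through the linear coefficients of z i alone; F then acts on the result.\<close>

definition twist :: "nat \<Rightarrow> (nat \<Rightarrow> series) \<Rightarrow> nat \<Rightarrow> series" where
  "twist d e i = (if i < N then hpart d (F (\<Sum>j<N. const (coef (z i) [j]) * e j)) else 0)"

lemma Vec_zero: "0 \<in> Vec d"
  by (simp add: Vec_def homog_zero)

lemma Vec_diff: "e \<in> Vec d \<Longrightarrow> e' \<in> Vec d \<Longrightarrow> e - e' \<in> Vec d"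
  by (simp add: Vec_def homog_diff)

lemma Vec_add: "e \<in> Vec d \<Longrightarrow> e' \<in> Vec d \<Longrightarrow> e + e' \<in> Vec d"
  by (simp add: Vec_def homog_add)

lemma Vec_homog: "e \<in> Vec d \<Longrightarrow> e i \<in> homog N d"
  by (cases "i < N") (simp_all add: Vec_def homog_zero)

lemma Vec_coef: "e \<in> Vec d \<Longrightarrow> coef (e i) w \<noteq> 0 \<Longrightarrow> i < N \<and> length w = d \<and> set w \<subseteq> {..<N}"
  by (cases "i < N") (auto simp: Vec_def homog_def)

lemma twist_Vec: "twist d e \<in> Vec d"
  by (simp add: Vec_def twist_def hpart_homog F.subst_supported)

lemma twist_diff: "twist d (e - e') = twist d e - twist d e'"
  by (simp add: fun_eq_iff twist_def right_diff_distrib sum_subtractf hpart_diff)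

lemma twist_scale: "twist d (\<lambda>i. const c * e i) = (\<lambda>i. const c * twist d e i)"
proof -
  have "const a * (const c * b) = const c * (const a * b)" for a and b :: series
    by (rule ncps_eqI) simp
  then show ?thesis
    by (simp add: fun_eq_iff twist_def hpart_const_mult[symmetric] sum_distrib_left[symmetric])
qed

lemma twist_mod_3: assumes "e \<in> Lat d" shows "\<exists>f\<in>Lat d. twist d e = e + (f + f + f)"
proof -
  have c: "cong3 (coef (twist d e i) w) (coef (e i) w)" for i w
  proof (cases "i < N \<and> length w = d")
    case False
    then have "coef (twist d e i) w = 0" "coef (e i) w = 0"
      using assms Vec_coef[OF twist_Vec, of d e i w] Vec_coef[of e d i w] unfolding Lat_def by auto
    then show ?thesis by (simp add: cong3_refl)
  next
    case True
    have e: "e j \<in> homog N d" for j using assms Vec_homog by (simp add: Lat_def)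
    have "coef (twist d e i) w = (\<Sum>j<N. coef (z i) [j] * coef (F (e j)) w)"
      using True by (simp add: twist_def coef_hpart F.subst_sum)
    also have "cong3 \<dots> (\<Sum>j<N. (if i = j then 1 else 0) * coef (e j) w)"
    proof (intro cong3_sum cong3_mult)
      show "cong3 (coef (z i) [j]) (if i = j then 1 else 0)" for j using True G.y_mod_3 by simp
      show "cong3 (coef (F (e j)) w) (coef (e j) w)" for j
      proof (rule F.coef_subst_mod_3)
        show "e j \<in> idl (length w)" using homog_idl[OF e] True by simp
        show "coef (e j) v \<in> \<int>" for v using assms by (simp add: Lat_def)
        show "coef (e j) v = 0" if "\<not> set v \<subseteq> {..<N}" for v using e[of j] that by (auto simp: homog_def)
      qed
    qed (use assms in \<open>auto simp: Lat_def\<close>)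
    also have "(\<Sum>j<N. (if i = j then 1 else 0) * coef (e j) w) = (\<Sum>j<N. if i = j then coef (e i) w else 0)"
      by (intro sum.cong) auto
    also have "\<dots> = coef (e i) w" using True by simp
    finally show ?thesis .
  qed
  define f where "f = (\<lambda>i. const (1/3) * (twist d e i - e i))"
  have "(\<lambda>i. const (1/3) * (twist d e i - e i)) \<in> Vec d"
    using Vec_diff[OF twist_Vec, of e d e] assms by (auto simp: Lat_def Vec_def homog_const_mult)
  moreover have "coef (f i) w \<in> \<int>" for i w
    using c[of i w] by (auto simp: f_def cong3_def)
  moreover have "twist d e = e + (f + f + f)"
    by (rule ext, rule ncps_eqI) (simp add: f_def algebra_simps)
  ultimately show ?thesis unfolding f_def Lat_def by blast
qed

lemma unipotent_twist: "unipotent_mod_3 (Lat d) (twist d)"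
proof
  show "0 \<in> Lat d" by (simp add: Lat_def Vec_zero)
  show "e - e' \<in> Lat d" if "e \<in> Lat d" "e' \<in> Lat d" for e e'
    using that by (auto simp: Lat_def Vec_diff)
  show "e = 0" if "e + e + e = 0" for e :: "nat \<Rightarrow> series"
  proof (rule ext, rule ncps_eqI)
    fix i w
    have "coef ((e + e + e) i) w = 0" unfolding that by simp
    then show "coef (e i) w = coef (0 i) w" by simp
  qed
  show "e = 0" if S: "S \<subseteq> Lat d" "\<And>e. e \<in> S \<Longrightarrow> \<exists>f\<in>S. e = f + f + f" "e \<in> S" for S and e :: "nat \<Rightarrow> series"
  proof (rule ext, rule ncps_eqI)
    fix i w
    have div: "\<exists>c. coef (e i) w = 3 ^ n * of_int c" if "e \<in> S" for n e
      using that
    proof (induction n arbitrary: e)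
      case 0
      then have "coef (e i) w \<in> \<int>" using S(1) by (auto simp: Lat_def)
      then show ?case by (auto elim!: Ints_cases)
    next
      case (Suc n)
      then obtain f where f: "f \<in> S" "e = f + f + f" using S(2) by blast
      obtain c where "coef (f i) w = 3 ^ n * of_int c" using Suc.IH f by blast
      then have "coef (e i) w = 3 ^ Suc n * of_int c" by (simp add: f(2))
      then show ?case by blast
    qed
    obtain c :: int where c: "coef (e i) w = of_int c" using div[OF S(3), of 0] by auto
    \<comment> \<open>The exponent |c| is large enough: 3^|c| exceeds |c| and cannot divide a
      nonzero c.\<close>
    obtain b :: int where "coef (e i) w = 3 ^ nat \<bar>c\<bar> * of_int b" using div[OF S(3)] by blast
    then have "(of_int c :: rat) = of_int (3 ^ nat \<bar>c\<bar> * b)" using c by simp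
    then have cb: "c = 3 ^ nat \<bar>c\<bar> * b" unfolding of_int_eq_iff .
    have "c = 0"
    proof (rule ccontr)
      assume "c \<noteq> 0"
      then have "3 ^ nat \<bar>c\<bar> \<le> \<bar>c\<bar>" using cb dvd_imp_le_int[of c "3 ^ nat \<bar>c\<bar>"] by (metis abs_of_nonneg dvd_triv_left zero_le_numeral zero_le_power)
      moreover have "int (nat \<bar>c\<bar>) < 2 ^ nat \<bar>c\<bar>" by (rule of_nat_less_two_power)
      moreover have "(2::int) ^ nat \<bar>c\<bar> \<le> 3 ^ nat \<bar>c\<bar>" by (rule power_mono) simp_all
      ultimately show False by simp
    qed
    then show "coef (e i) w = coef (0 i) w" using c by simp
  qed
qed (simp_all add: twist_diff twist_mod_3)

lemma twist_kernel:
  assumes e: "e \<in> Vec d" "k > 0" "(\<Sum>j<k. (twist d ^^ j) e) = 0"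
  shows "e = 0"
proof -
  \<comment> \<open>D clears the finitely many denominators of e. Scaling commutes with
    \<open>twist\<close>, so the lattice argument reaches rational families.\<close>
  have "finite {w. set w \<subseteq> {..<N} \<and> length w = d}" by (simp add: finite_lists_length_eq)
  then obtain D :: int where D: "D > 0"
    "\<And>i w. i < N \<Longrightarrow> set w \<subseteq> {..<N} \<Longrightarrow> length w = d \<Longrightarrow> of_int D * coef (e i) w \<in> \<int>"
    using common_denominator[of "(\<lambda>(i, w). coef (e i) w) ` ({..<N} \<times> {w. set w \<subseteq> {..<N} \<and> length w = d})"]
    by auto
  define e' where "e' = (\<lambda>i. const (of_int D) * e i)"
  have "e' \<in> Vec d" using e unfolding e'_def Vec_def by (simp add: homog_const_mult)
  moreover have "coef (e' i) w \<in> \<int>" for i w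
    using D(2)[of i w] Vec_coef[OF e(1), of i w] by (cases "coef (e i) w = 0") (auto simp: e'_def)
  ultimately have L: "e' \<in> Lat d" by (simp add: Lat_def)
  have pow: "(twist d ^^ j) e' = (\<lambda>i. const (of_int D) * (twist d ^^ j) e i)" for j
    by (induction j) (simp_all add: e'_def twist_scale)
  have "(\<Sum>j<k. (twist d ^^ j) e') i = const (of_int D) * (\<Sum>j<k. (twist d ^^ j) e) i" for i
    unfolding sum_fun_apply pow by (simp add: sum_distrib_left)
  then have "(\<Sum>j<k. (twist d ^^ j) e') = 0" using e(3) by (simp add: fun_eq_iff)
  then have "e' = 0" using unipotent_mod_3_kernel[OF unipotent_twist e(2) L] by blast
  show ?thesis
  proof (rule ext, rule ncps_eqI)
    fix i w
    have "coef (e' i) w = 0" using \<open>e' = 0\<close> by simp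
    then show "coef (e i) w = coef (0 i) w" using D by (simp add: e'_def)
  qed
qed

end

section \<open>Roots up to conjugation\<close>

context twisted_pair
begin

lemma twist_zero: "twist d 0 = 0"
  using twist_diff[of d 0 0] by simp

lemma twist_add: "twist d (e + e') = twist d e + twist d e'"
  using twist_diff[of d e "- e'"] twist_diff[of d 0 e'] twist_zero by simp

lemma twist_sum: "twist d (\<Sum>j\<in>S. e j) = (\<Sum>j\<in>S. twist d (e j))"
  by (induction S rule: infinite_finite_induct)
    (simp_all only: sum.infinite sum.empty sum.insert twist_zero twist_add not_False_eq_True)

lemma twist_power_Vec: "e \<in> Vec d \<Longrightarrow> (twist d ^^ n) e \<in> Vec d"
  by (induction n) (simp_all add: twist_Vec)

lemma twist_power_diff: "(twist d ^^ n) (e - e') = (twist d ^^ n) e - (twist d ^^ n) e'"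
  by (induction n) (simp_all only: funpow.simps o_apply id_apply twist_diff)

lemma Vec_sum: "(\<And>j. j \<in> S \<Longrightarrow> e j \<in> Vec d) \<Longrightarrow> (\<Sum>j\<in>S. e j) \<in> Vec d"
  by (induction S rule: infinite_finite_induct) (simp_all add: Vec_zero Vec_add)

text \<open>Peel off the outermost F and the innermost G. By induction F^n G^n is conjugate to X_i +
  S i, so its value on z i is conjugate to z i plus a linear combination W of the S j. Applying F
  gives X_i + delta i + \<open>twist (Suc m) S i\<close> up to conjugation, and the conjugator
  becomes F u times u0.\<close>

lemma iterate_conj:
  assumes u0: "coef u0 [] = 1" and delta: "delta \<in> Vec (Suc m)"
    and theta: "\<And>i. i < N \<Longrightarrow>
      idl_cong (Suc (Suc m)) (F (G (ncvar i)) * u0) (u0 * (ncvar i + delta i))"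
  shows "\<exists>u. coef u [] = 1 \<and> (\<forall>i<N. idl_cong (Suc (Suc m)) ((F ^^ n) ((G ^^ n) (ncvar i)) * u)
      (u * (ncvar i + (\<Sum>l<n. (twist (Suc m) ^^ l) delta) i)))"
proof (induction n)
  case 0
  show ?case by (rule exI[of _ 1]) (simp add: coef_one)
next
  case (Suc n)
  let ?M = "Suc (Suc m)"
  define S where "S = (\<Sum>l<n. (twist (Suc m) ^^ l) delta)"
  define \<Theta> where "\<Theta> = (\<lambda>i. (F ^^ n) ((G ^^ n) (ncvar i)))"
  obtain u where u: "coef u [] = 1" "\<And>i. i < N \<Longrightarrow> idl_cong ?M (\<Theta> i * u) (u * (ncvar i + S i))"
    using Suc unfolding S_def \<Theta>_def by blast
  have "S \<in> Vec (Suc m)" unfolding S_def by (intro Vec_sum twist_power_Vec delta)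
  then have S: "S i \<in> idl (Suc m)" for i by (intro homog_idl[OF Vec_homog])
  interpret Gn: substitution N "\<lambda>i. (G ^^ n) (ncvar i)"
    by (rule funpow_subst_compose(1)[OF G.substitution_axioms ncvar_subst.substitution_axioms])
  interpret Th: substitution N \<Theta>
    unfolding \<Theta>_def by (rule funpow_subst_compose(1)[OF F.substitution_axioms Gn.substitution_axioms])
  have Th: "(F ^^ n) ((G ^^ n) (z i)) = subst N \<Theta> (z i)" if "i < N" for i
  proof -
    have "(G ^^ n) (z i) = (G ^^ n) (subst N ncvar (z i))" using G.y_supported[OF that] by simp
    also have "\<dots> = subst N (\<lambda>i. (G ^^ n) (ncvar i)) (z i)"
      by (rule funpow_subst_compose(2)[OF G.substitution_axioms ncvar_subst.substitution_axioms])
    finally show ?thesis unfolding \<Theta>_def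
      using funpow_subst_compose(2)[OF F.substitution_axioms Gn.substitution_axioms] by simp
  qed
  have XS: "substitution N (\<lambda>i. ncvar i + S i)"
    by unfold_locales (intro idl_add ncvar_idl idl_mono[OF S], simp)
  have sum: "(\<Sum>l<Suc n. (twist (Suc m) ^^ l) delta) = delta + twist (Suc m) S"
    unfolding S_def twist_sum by (simp add: sum.lessThan_Suc_shift del: sum.lessThan_Suc)
  show ?case
  proof (intro exI[of _ "F u * u0"] conjI allI impI)
    show "coef (F u * u0) [] = 1" using u u0 by simp
    fix i assume i: "i < N"
    define W where "W = (\<Sum>j<N. const (coef (z i) [j]) * S j)"
    have W: "W \<in> idl (Suc m)" unfolding W_def by (intro idl_sum idl_mult_left S)
    have "idl_cong ?M (subst N \<Theta> (z i) * u) (u * subst N (\<lambda>i. ncvar i + S i) (z i))"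
      unfolding idl_cong_def
      by (rule Th.subst_intertwine[OF XS]) (use u(2) in \<open>simp add: idl_cong_def\<close>)
    also have "idl_cong ?M \<dots> (u * (z i + W))"
    proof (rule idl_cong_mult_left)
      show "idl_cong ?M (subst N (\<lambda>i. ncvar i + S i) (z i)) (z i + W)"
        using ncvar_subst.subst_perturb[of N S m "z i"] S G.y_supported[OF i]
        unfolding idl_cong_def W_def by (simp add: diff_diff_eq)
    qed
    finally have "idl_cong ?M (F (subst N \<Theta> (z i) * u)) (F (u * (z i + W)))"
      by (rule F.subst_idl_cong)
    then have "idl_cong ?M (F (subst N \<Theta> (z i)) * F u * u0) (F u * (F (z i) + F W) * u0)"
      by (intro idl_cong_mult_right) simp
    also have "F u * (F (z i) + F W) * u0 = F u * (F (z i) * u0 + F W * u0)"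
      by (simp add: algebra_simps)
    also have "idl_cong ?M \<dots> (F u * (u0 * (ncvar i + delta i) + u0 * twist (Suc m) S i))"
    proof (intro idl_cong_mult_left idl_cong_add)
      show "idl_cong ?M (F (z i) * u0) (u0 * (ncvar i + delta i))" using theta[OF i] i by simp
      have "idl_cong ?M (F W * u0) (F W)" by (rule idl_cong_commute_unit[OF F.subst_idl[OF W] u0])
      also have "idl_cong ?M \<dots> (twist (Suc m) S i)"
        using idl_cong_hpart[OF F.subst_idl[OF W]] i by (simp add: twist_def W_def)
      also have "idl_cong ?M \<dots> (u0 * twist (Suc m) S i)"
        by (rule idl_cong_sym, rule idl_cong_commute_unit[OF homog_idl[OF Vec_homog[OF twist_Vec]] u0])
      finally show "idl_cong ?M (F W * u0) (u0 * twist (Suc m) S i)" .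
    qed
    finally show "idl_cong ?M ((F ^^ Suc n) ((G ^^ Suc n) (ncvar i)) * (F u * u0))
        (F u * u0 * (ncvar i + (\<Sum>l<Suc n. (twist (Suc m) ^^ l) delta) i))"
      unfolding sum using i Th[OF i] by (simp add: funpow_swap1 algebra_simps)
  qed
qed

text \<open>Since H conjugates exactly, f = H^(-1) u - 1 satisfies X_i f - f X_i = e i modulo order
  m + 2. As e has order m + 1, \<open>centralizer_lead\<close> raises the order of f step by step up
  to m, and its part of degree m supplies h.\<close>

lemma commutator_of_conj:
  assumes N: "2 \<le> N" and H: "coef H [] = 1" "\<And>i. i < N \<Longrightarrow> \<Theta> i * H = H * ncvar i"
    and u: "coef u [] = 1" "\<And>i. i < N \<Longrightarrow> idl_cong (Suc (Suc m)) (\<Theta> i * u) (u * (ncvar i + e i))"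
    and e: "e \<in> Vec (Suc m)"
  shows "\<exists>h\<in>homog N m. (m = 0 \<longrightarrow> h = 0) \<and> (\<forall>i<N. e i = ncvar i * h - h * ncvar i)"
proof -
  let ?M = "Suc (Suc m)"
  obtain H' where H': "H * H' = 1" "H' * H = 1" using inverse_exists[OF H(1)] by blast
  have H'1: "coef H' [] = 1" using H'(1) H(1) coef_mult_Nil[of H H'] by (simp add: coef_one)
  define f where "f = H' * u - 1"
  have f1: "f \<in> idl 1" unfolding idl_1_iff using H'1 u(1) by (simp add: f_def coef_one)
  have e_idl: "e i \<in> idl (Suc m)" for i by (rule homog_idl[OF Vec_homog[OF e]])
  have ef: "idl_cong ?M (e i) (ncvar i * f - f * ncvar i)" if i: "i < N" for i
  proof -
    have "H' * \<Theta> i = H' * (\<Theta> i * H) * H'" using H'(1) by (simp add: mult.assoc)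
    also have "\<dots> = ncvar i * H'" unfolding H(2)[OF i] using H'(2) by (simp add: mult.assoc[symmetric])
    finally have "ncvar i * (H' * u) = H' * (\<Theta> i * u)" by (metis mult.assoc)
    also have "idl_cong ?M \<dots> (H' * (u * (ncvar i + e i)))" by (rule idl_cong_mult_left[OF u(2)[OF i]])
    also have "H' * (u * (ncvar i + e i)) = H' * u * ncvar i + H' * u * e i" by (simp add: algebra_simps)
    also have "idl_cong ?M \<dots> (H' * u * ncvar i + e i)"
      by (intro idl_cong_add idl_cong_refl idl_cong_commute_unit e_idl) (simp add: H'1 u(1))
    finally have "idl_cong ?M (H' * u * ncvar i + e i) (ncvar i * (H' * u))" by (rule idl_cong_sym)
    then have "idl_cong ?M (H' * u * ncvar i + e i - H' * u * ncvar i) (ncvar i * (H' * u) - H' * u * ncvar i)"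
      by (intro idl_cong_diff idl_cong_refl)
    then show ?thesis by (simp add: f_def algebra_simps)
  qed
  have "f \<in> idl l" if "l \<le> m" for l
    using that
  proof (induction l)
    case (Suc l)
    have "f * ncvar i - ncvar i * f \<in> idl (Suc (Suc l))" if "i < N" for i
    proof -
      have "ncvar i * f - f * ncvar i \<in> idl (Suc m)"
        using idl_cong_idl[OF idl_cong_sym[OF idl_cong_mono[OF ef[OF that]]] e_idl] by simp
      then have "- (ncvar i * f - f * ncvar i) \<in> idl (Suc m)" by (rule idl_uminus)
      then have "f * ncvar i - ncvar i * f \<in> idl (Suc m)" by simp
      then show ?thesis by (rule idl_mono) (use Suc.prems in simp)
    qed
    then show ?case
      using centralizer_lead[OF N Suc.IH] Suc.prems f1 by (cases "l = 0") simp_all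
  qed simp
  then have fm: "f \<in> idl m" by simp
  \<comment> \<open>f may involve variables beyond the first N. Projecting them away preserves the
    relation because e does not involve them.\<close>
  define p where "p = subst N ncvar f"
  define h where "h = hpart m p"
  have p: "p \<in> idl m" "subst N ncvar p = p" "p \<in> idl 1"
    unfolding p_def by (auto intro: ncvar_subst.subst_idl fm f1 simp: ncvar_subst.subst_comp[OF ncvar_subst.substitution_axioms]
        simp del: One_nat_def intro!: subst_cong)
  have h: "h \<in> homog N m" unfolding h_def by (rule hpart_homog[OF p(2)])
  show ?thesis
  proof (intro bexI[OF _ h] conjI impI allI)
    show "h = 0" if "m = 0"
      by (rule ncps_eqI) (use p(3) in \<open>auto simp: h_def coef_hpart that idl_def\<close>)
    fix i assume i: "i < N"
    have "idl_cong ?M (e i) (subst N ncvar (ncvar i * f - f * ncvar i))"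
      using ncvar_subst.subst_idl_cong[OF ef[OF i], of N] homog_supported[OF Vec_homog[OF e]] by simp
    also have "subst N ncvar (ncvar i * f - f * ncvar i) = ncvar i * p - p * ncvar i"
      using i by (simp add: p_def)
    also have "idl_cong ?M \<dots> (ncvar i * h - h * ncvar i)"
    proof -
      have ph: "p - h \<in> idl (Suc m)" using idl_cong_hpart[OF p(1)] by (simp add: idl_cong_def h_def)
      have "ncvar i * (p - h) - (p - h) * ncvar i \<in> idl ?M"
        by (rule idl_diff[OF idl_Suc_mult_left[OF ncvar_idl ph] idl_Suc_mult_right[OF ph ncvar_idl]])
      then show ?thesis by (simp add: idl_cong_def algebra_simps)
    qed
    finally show "e i = ncvar i * h - h * ncvar i"
      using homog_idl_cong[OF Vec_homog[OF e]] homog_uminus[OF homog_commutator[OF h i]] by simp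
  qed
qed

section \<open>Inner derivations and the leading action of F\<close>

definition inner_der :: "series \<Rightarrow> nat \<Rightarrow> series" where
  "inner_der v i = (if i < N then v * ncvar i - ncvar i * v else 0)"

lemma inner_der_Vec: "v \<in> homog N m \<Longrightarrow> inner_der v \<in> Vec (Suc m)"
  by (simp add: Vec_def inner_der_def homog_commutator)

lemma inner_der_zero: "inner_der 0 = 0"
  by (simp add: fun_eq_iff inner_der_def)

lemma inner_der_add: "inner_der (v + w) = inner_der v + inner_der w"
  by (simp add: fun_eq_iff inner_der_def algebra_simps)

lemma inner_der_sum: "inner_der (\<Sum>j\<in>S. v j) = (\<Sum>j\<in>S. inner_der (v j))"
  by (induction S rule: infinite_finite_induct) (simp_all add: inner_der_zero inner_der_add)

lemma inner_der_kernel: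
  assumes "2 \<le> N" "0 < m" "v \<in> homog N m" "inner_der v = 0"
  shows "v = 0"
proof (rule homog_idl_Suc[OF assms(3)])
  show "v \<in> idl (Suc m)"
  proof (rule centralizer_lead[OF assms(1) homog_idl[OF assms(3)] assms(2)])
    fix i assume "i < N"
    moreover have "inner_der v i = 0" using assms(4) by simp
    ultimately show "v * ncvar i - ncvar i * v \<in> idl (Suc (Suc m))" by (simp add: inner_der_def)
  qed
qed

definition lin :: "nat \<Rightarrow> series \<Rightarrow> series" where
  "lin m a = hpart m (F a)"

lemma lin_homog: "lin m a \<in> homog N m"
  unfolding lin_def by (rule hpart_homog[OF F.subst_supported])

lemma lin_power_homog: "a \<in> homog N m \<Longrightarrow> (lin m ^^ j) a \<in> homog N m"
  by (induction j) (simp_all add: lin_homog)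

text \<open>Let b be the linear part of z i. The twisted value is the leading part of F [v, b] =
  [F v, F b], and F b agrees with X_i modulo order 2 since F after G is the identity there. So T
  preserves inner derivations and acts on v through F alone.\<close>

lemma twist_inner_der:
  assumes lin: "\<And>i. i < N \<Longrightarrow> idl_cong 2 (F (G (ncvar i))) (ncvar i)" and v: "v \<in> homog N m"
  shows "twist (Suc m) (inner_der v) = inner_der (lin m v)"
proof
  fix i
  show "twist (Suc m) (inner_der v) i = inner_der (lin m v) i"
  proof (cases "i < N")
    case i: True
    define b where "b = (\<Sum>j<N. const (coef (z i) [j]) * ncvar j)"
    have W: "(\<Sum>j<N. const (coef (z i) [j]) * inner_der v j) = v * b - b * v"
      unfolding b_def sum_distrib_left sum_distrib_right sum_subtractf[symmetric]
      by (intro sum.cong refl) (simp add: inner_der_def right_diff_distrib mult.assoc[symmetric] const_commute[of v])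
    have "idl_cong 2 (z i) b"
      unfolding idl_cong_def idl_def
    proof (clarify)
      fix w :: "nat list" assume w: "length w < 2"
      show "coef (z i - b) w = 0"
      proof (cases w)
        case Nil
        then show ?thesis using G.y[OF i] unfolding idl_1_iff by (simp add: b_def coef_ncvar)
      next
        case (Cons x w')
        then have wx: "w = [x]" using w by simp
        have "coef b [x] = (\<Sum>j<N. if j = x then coef (z i) [x] else 0)"
          unfolding b_def coef_sum by (intro sum.cong refl) (simp add: coef_ncvar)
        moreover have "coef (z i) [x] = 0" if "\<not> x < N"
          using arg_cong[OF G.y_supported[OF i], of "\<lambda>a. coef a [x]"] that by (simp add: coef_subst_ncvar)
        ultimately show ?thesis by (auto simp: wx)
      qed
    qed
    then have "idl_cong 2 (F b) (F (z i))" by (intro idl_cong_sym[OF F.subst_idl_cong])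
    also have "idl_cong 2 (F (z i)) (ncvar i)" using lin[OF i] i by simp
    finally have Fb: "F b - ncvar i \<in> idl (Suc 1)" by (simp add: idl_cong_def numeral_2_eq_2)
    have Fv: "F v - lin m v \<in> idl (Suc m)"
      using idl_cong_hpart[OF F.subst_idl[OF homog_idl[OF v]]] by (simp add: lin_def idl_cong_def)
    have Fvm: "F v \<in> idl m" by (rule F.subst_idl[OF homog_idl[OF v]])
    have "F (v * b - b * v) - (lin m v * ncvar i - ncvar i * lin m v) =
       (F v * (F b - ncvar i) - (F b - ncvar i) * F v) + ((F v - lin m v) * ncvar i - ncvar i * (F v - lin m v))"
      by (simp add: algebra_simps)
    also have "\<dots> \<in> idl (Suc (Suc m))"
    proof (rule idl_add)
      show "F v * (F b - ncvar i) - (F b - ncvar i) * F v \<in> idl (Suc (Suc m))"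
        using idl_diff[OF idl_mult[OF Fvm Fb] idl_mono[OF idl_mult[OF Fb Fvm]]] by simp
      show "(F v - lin m v) * ncvar i - ncvar i * (F v - lin m v) \<in> idl (Suc (Suc m))"
        by (rule idl_diff[OF idl_Suc_mult_right[OF Fv ncvar_idl] idl_Suc_mult_left[OF ncvar_idl Fv]])
    qed
    finally have "hpart (Suc m) (F (v * b - b * v)) = hpart (Suc m) (lin m v * ncvar i - ncvar i * lin m v)"
      by (intro hpart_idl_cong) (simp add: idl_cong_def)
    then show ?thesis
      using i W homog_hpart[OF homog_commutator[OF lin_homog i]] by (simp add: twist_def inner_der_def)
  qed (simp add: twist_def inner_der_def)
qed

lemma twist_power_inner_der:
  assumes "\<And>i. i < N \<Longrightarrow> idl_cong 2 (F (G (ncvar i))) (ncvar i)" "v \<in> homog N m"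
  shows "(twist (Suc m) ^^ j) (inner_der v) = inner_der ((lin m ^^ j) v)"
  by (induction j) (simp_all add: twist_inner_der[OF assms(1)] lin_power_homog[OF assms(2)])

lemma homog_sum: "(\<And>j. j \<in> S \<Longrightarrow> a j \<in> homog N m) \<Longrightarrow> (\<Sum>j\<in>S. a j) \<in> homog N m"
  by (induction S rule: infinite_finite_induct) (simp_all add: homog_zero homog_add)

end

section \<open>A finite spanning set for each homogeneous space\<close>

lift_definition monomial :: "'i list \<Rightarrow> ('i, 'a::comm_ring_1) ncps" is "\<lambda>s w. if w = s then 1 else 0" .

lemma coef_monomial: "coef (monomial s) w = (if w = s then 1 else 0)"
  by transfer simp

interpretation series_vs: vector_space "\<lambda>c (a :: series). const c * a"
  by unfold_locales (simp_all add: algebra_simps const_add const_mult)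

lemma homog_span: "series_vs.span (monomial ` {w. set w \<subseteq> {..<N} \<and> length w = m}) = homog N m"
proof
  have "series_vs.subspace (homog N m)"
    by (simp add: series_vs.subspace_def homog_zero homog_add homog_const_mult)
  moreover have "monomial ` {w. set w \<subseteq> {..<N} \<and> length w = m} \<subseteq> homog N m"
    by (auto simp: homog_def coef_monomial split: if_splits)
  ultimately show "series_vs.span (monomial ` {w. set w \<subseteq> {..<N} \<and> length w = m}) \<subseteq> homog N m"
    by (rule series_vs.span_minimal[rotated])
  show "homog N m \<subseteq> series_vs.span (monomial ` {w. set w \<subseteq> {..<N} \<and> length w = m})"
  proof
    fix a :: series assume a: "a \<in> homog N m"
    let ?W = "{w. set w \<subseteq> {..<N} \<and> length w = m}"
    have fin: "finite ?W" by (simp add: finite_lists_length_eq)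
    have "a = (\<Sum>s\<in>?W. const (coef a s) * monomial s)"
    proof (rule ncps_eqI)
      fix w
      have "(\<Sum>s\<in>?W. coef a s * coef (monomial s) w) = (\<Sum>s\<in>?W. if w = s then coef a s else 0)"
        by (intro sum.cong refl) (simp add: coef_monomial)
      then show "coef a w = coef (\<Sum>s\<in>?W. const (coef a s) * monomial s) w"
        using a fin by (auto simp: homog_def)
    qed
    also have "\<dots> \<in> series_vs.span (monomial ` ?W)"
      by (intro series_vs.span_sum series_vs.span_scale series_vs.span_base) auto
    finally show "a \<in> series_vs.span (monomial ` ?W)" .
  qed
qed

context twisted_pair
begin

text \<open>\<open>inner_der\<close> is injective in positive degree and carries the powers of
  \<open>lin m\<close> to those of \<open>twist\<close>, so the sum of the powers inherits
  injectivity from \<open>twist_kernel\<close>; finite dimension makes it onto. The preimage v may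
  have denominators even if h has none.\<close>

lemma lin_power_sum_surj:
  assumes N: "2 \<le> N" and m: "0 < m" and k: "0 < k"
    and lin: "\<And>i. i < N \<Longrightarrow> idl_cong 2 (F (G (ncvar i))) (ncvar i)" and h: "h \<in> homog N m"
  shows "\<exists>v\<in>homog N m. (\<Sum>j<k. (lin m ^^ j) v) = h"
proof -
  define P where "P = (\<lambda>v. \<Sum>j<k. (lin m ^^ j) v)"
  have pow_add: "(lin m ^^ j) (a + b) = (lin m ^^ j) a + (lin m ^^ j) b" for j a b
    by (induction j) (simp_all add: lin_def hpart_add)
  have pow_scale: "(lin m ^^ j) (const c * a) = const c * (lin m ^^ j) a" for j c a
    by (induction j) (simp_all add: lin_def hpart_const_mult)
  have linear: "Vector_Spaces.linear (\<lambda>c (a :: series). const c * a) (\<lambda>c (a :: series). const c * a) P"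
    unfolding Vector_Spaces.linear_iff
    using series_vs.vector_space_axioms
    by (auto simp: P_def pow_add pow_scale sum.distrib sum_distrib_left)
  interpret P: Vector_Spaces.linear "\<lambda>c (a :: series). const c * a" "\<lambda>c (a :: series). const c * a" P
    by (fact linear)
  let ?B = "monomial ` {w. set w \<subseteq> {..<N} \<and> length w = m} :: series set"
  have "homog N m \<subseteq> P ` homog N m"
  proof (rule series_vs.inj_endo_surj[OF linear, of ?B, unfolded homog_span])
    show "finite ?B" by (simp add: finite_lists_length_eq)
    show "P ` homog N m \<subseteq> homog N m"
      unfolding P_def by (auto intro!: homog_sum lin_power_homog)
    show "inj_on P (homog N m)"
    proof (rule inj_onI)
      fix v w :: series assume vw: "v \<in> homog N m" "w \<in> homog N m" "P v = P w"
      have d: "v - w \<in> homog N m" using vw by (simp add: homog_diff)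
      have "P (v - w) = 0" using vw by (simp add: P.diff)
      moreover have "(\<Sum>j<k. (twist (Suc m) ^^ j) (inner_der (v - w))) = inner_der (P (v - w))"
        unfolding P_def inner_der_sum by (intro sum.cong refl twist_power_inner_der lin d)
      ultimately have "(\<Sum>j<k. (twist (Suc m) ^^ j) (inner_der (v - w))) = 0"
        by (simp only: inner_der_zero)
      then have "inner_der (v - w) = 0"
        using twist_kernel[OF inner_der_Vec[OF d] k] by blast
      then show "v = w" using inner_der_kernel[OF N m d] by simp
    qed
  qed
  then show ?thesis using h unfolding P_def by blast
qed

text \<open>Conjugacy holds through degree m, so the first possible error sits in degree m + 1. The
  support of u is recorded to keep that error in \<open>Vec\<close>.\<close>

definition approx_conj :: "nat \<Rightarrow> series \<Rightarrow> bool" where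
  "approx_conj m u \<longleftrightarrow> coef u [] = 1 \<and> subst N ncvar u = u \<and>
     (\<forall>i<N. idl_cong (Suc m) (F (G (ncvar i)) * u) (u * ncvar i))"

text \<open>By \<open>commutator_of_conj\<close> the accumulated error e is
  \<open>inner_der (- h)\<close>. For v with sum of \<open>lin m\<close> powers equal to - h, both
  delta and \<open>inner_der v\<close> are sent to e by 1 + T + ... + T^(k-1). Hence they agree, and
  u (1 + v) is the corrected conjugator.\<close>

lemma approx_conj_step:
  assumes N: "2 \<le> N" and k: "0 < k" and H: "coef H [] = 1"
      "\<And>i. i < N \<Longrightarrow> (F ^^ k) ((G ^^ k) (ncvar i)) * H = H * ncvar i"
    and u: "approx_conj m u"
  shows "\<exists>u'. approx_conj (Suc m) u' \<and> u' - u \<in> idl m"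
proof -
  let ?M = "Suc (Suc m)"
  have u1: "coef u [] = 1" and us: "subst N ncvar u = u"
    and uc: "\<And>i. i < N \<Longrightarrow> idl_cong (Suc m) (F (G (ncvar i)) * u) (u * ncvar i)"
    using u by (auto simp: approx_conj_def)
  define r where "r = (\<lambda>i. F (G (ncvar i)) * u - u * ncvar i)"
  define delta where "delta = (\<lambda>i. if i < N then hpart (Suc m) (r i) else 0)"
  have r: "r i \<in> idl (Suc m)" if "i < N" for i using uc[OF that] by (simp add: idl_cong_def r_def)
  have delta: "delta \<in> Vec (Suc m)"
    unfolding Vec_def delta_def
    using us by (auto intro!: hpart_homog simp: r_def F.subst_supported simp del: F.subst_ncvar G.subst_ncvar)
  have theta: "idl_cong ?M (F (G (ncvar i)) * u) (u * (ncvar i + delta i))" if i: "i < N" for i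
  proof -
    have "F (G (ncvar i)) * u = u * ncvar i + r i" by (simp add: r_def)
    also have "idl_cong ?M \<dots> (u * ncvar i + u * delta i)"
    proof (rule idl_cong_add[OF idl_cong_refl])
      have "idl_cong ?M (r i) (delta i)" using idl_cong_hpart[OF r[OF i]] i by (simp add: delta_def)
      also have "idl_cong ?M \<dots> (u * delta i)"
        by (rule idl_cong_sym, rule idl_cong_commute_unit[OF homog_idl[OF Vec_homog[OF delta]] u1])
      finally show "idl_cong ?M (r i) (u * delta i)" .
    qed
    finally show ?thesis by (simp add: distrib_left)
  qed
  define e where "e = (\<Sum>l<k. (twist (Suc m) ^^ l) delta)"
  have eV: "e \<in> Vec (Suc m)" unfolding e_def by (intro Vec_sum twist_power_Vec delta)
  obtain w where w: "coef w [] = 1"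
    "\<And>i. i < N \<Longrightarrow> idl_cong ?M ((F ^^ k) ((G ^^ k) (ncvar i)) * w) (w * (ncvar i + e i))"
    using iterate_conj[OF u1 delta theta, of k] unfolding e_def by blast
  obtain h where h: "h \<in> homog N m" "m = 0 \<Longrightarrow> h = 0"
    "\<And>i. i < N \<Longrightarrow> e i = ncvar i * h - h * ncvar i"
    using commutator_of_conj[OF N H w eV] by blast
  have "\<exists>v\<in>homog N m. (m = 0 \<longrightarrow> v = 0) \<and> delta = inner_der v"
  proof -
    have eh: "e = inner_der (- h)"
    proof
      fix i
      show "e i = inner_der (- h) i"
        using h(3)[of i] eV by (cases "i < N") (simp_all add: inner_der_def Vec_def)
    qed
    show ?thesis
    proof (cases "m = 0")
      \<comment> \<open>Degree 0 allows no correction. Here e = 0 and hence delta = 0, so F after G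
        is the identity on linear terms; the later degrees rely on this through
        \<open>lin\<close>.\<close>
      case True
      then have "e = 0" using eh h(2) inner_der_zero by simp
      then have "delta = 0" unfolding e_def by (rule twist_kernel[OF delta k])
      then show ?thesis using inner_der_zero by (intro bexI[OF _ homog_zero]) simp
    next
      case False
      have lin: "idl_cong 2 (F (G (ncvar i))) (ncvar i)" if i: "i < N" for i
      proof -
        have F1: "F (G (ncvar i)) \<in> idl 1"
          by (rule F.subst_idl, rule G.subst_idl, rule ncvar_idl)
        have "idl_cong (Suc 1) (F (G (ncvar i))) (F (G (ncvar i)) * u)"
          by (rule idl_cong_sym, rule idl_cong_commute_unit[OF F1 u1])
        also have "idl_cong (Suc 1) \<dots> (u * ncvar i)" by (rule idl_cong_mono[OF uc[OF i]]) (use False in simp)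
        also have "idl_cong (Suc 1) \<dots> (ncvar i)" by (rule idl_cong_commute_unit[OF ncvar_idl u1])
        finally show ?thesis by (simp add: numeral_2_eq_2)
      qed
      obtain v where v: "v \<in> homog N m" "(\<Sum>j<k. (lin m ^^ j) v) = - h"
        using lin_power_sum_surj[OF N _ k lin homog_uminus[OF h(1)]] False by blast
      have "(\<Sum>j<k. (twist (Suc m) ^^ j) (inner_der v)) = inner_der (- h)"
        unfolding v(2)[symmetric] inner_der_sum by (intro sum.cong refl twist_power_inner_der lin v)
      then have "(\<Sum>j<k. (twist (Suc m) ^^ j) (delta - inner_der v)) = e - inner_der (- h)"
        unfolding twist_power_diff sum_subtractf e_def by (simp only:)
      then have "delta - inner_der v = 0"
        using twist_kernel[OF Vec_diff[OF delta inner_der_Vec[OF v(1)]] k] eh by simp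
      then show ?thesis using v False by auto
    qed
  qed
  then obtain v where v: "v \<in> homog N m" "m = 0 \<Longrightarrow> v = 0" "delta = inner_der v" by blast
  show ?thesis
  proof (intro exI[of _ "u * (1 + v)"] conjI)
    show "u * (1 + v) - u \<in> idl m"
      using idl_mult_left[OF homog_idl[OF v(1)]] by (simp add: distrib_left)
    show "approx_conj (Suc m) (u * (1 + v))"
      unfolding approx_conj_def
    proof (intro conjI allI impI)
      have "coef v [] = 0" using v by (cases "m = 0") (auto simp: homog_def)
      then show "coef (u * (1 + v)) [] = 1" by (simp add: u1 coef_one)
      show "subst N ncvar (u * (1 + v)) = u * (1 + v)" using us homog_supported[OF v(1)] by simp
      fix i assume i: "i < N"
      have d: "delta i = v * ncvar i - ncvar i * v" using i by (simp add: v(3) inner_der_def)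
      have "idl_cong ?M (F (G (ncvar i)) * u * (1 + v)) (u * (ncvar i + delta i) * (1 + v))"
        by (rule idl_cong_mult_right[OF theta[OF i]])
      \<comment> \<open>The terms X_i v and - X_i v cancel. The remaining product of delta i and v
        has order 2 m + 1, which is at least m + 2 once m is positive.\<close>
      also have "u * (ncvar i + delta i) * (1 + v) = u * ((1 + v) * ncvar i + delta i * v)"
        unfolding d by (simp add: algebra_simps)
      also have "idl_cong ?M \<dots> (u * ((1 + v) * ncvar i))"
      proof (rule idl_cong_mult_left)
        have "delta i * v \<in> idl ?M"
        proof (cases "m = 0")
          case False
          then show ?thesis
            using idl_mono[OF idl_mult[OF homog_idl[OF Vec_homog[OF delta]] homog_idl[OF v(1)]]] by simp
        qed (simp add: v(2))
        then show "idl_cong ?M ((1 + v) * ncvar i + delta i * v) ((1 + v) * ncvar i)"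
          by (simp add: idl_cong_def)
      qed
      finally show "idl_cong ?M (F (G (ncvar i)) * (u * (1 + v))) (u * (1 + v) * ncvar i)"
        by (simp add: mult.assoc)
    qed
  qed
qed

theorem conj_of_conj_power:
  assumes N: "2 \<le> N" and k: "0 < k" and H: "coef H [] = 1"
      "\<And>i. i < N \<Longrightarrow> (F ^^ k) ((G ^^ k) (ncvar i)) * H = H * ncvar i"
  shows "\<exists>u. coef u [] = 1 \<and> (\<forall>i<N. F (G (ncvar i)) * u = u * ncvar i)"
proof -
  have "approx_conj 0 1"
    unfolding approx_conj_def idl_cong_def
    by (auto simp: coef_one simp del: F.subst_ncvar G.subst_ncvar One_nat_def
        intro!: idl_diff ncvar_idl F.subst_idl G.subst_idl simp flip: One_nat_def)
  then obtain us where us: "\<And>m. approx_conj m (us m)" "\<And>m. us (Suc m) - us m \<in> idl m"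
    using dependent_nat_choice[of approx_conj "\<lambda>m u u'. u' - u \<in> idl m"]
      approx_conj_step[OF N k H] by (metis (no_types))
  \<comment> \<open>From index n on, the approximations agree on words shorter than n, so a word of
    length l is read off at index l + 1.\<close>
  define u where "u = Abs_ncps (\<lambda>w. coef (us (Suc (length w))) w)"
  have step: "us (n + d) - us n \<in> idl n" for n d
  proof (induction d)
    case (Suc d)
    have "us (n + Suc d) - us n = (us (Suc (n + d)) - us (n + d)) + (us (n + d) - us n)" by simp
    then show ?case using idl_add[OF idl_mono[OF us(2)] Suc, of "n + d"] by simp
  qed simp
  have u: "idl_cong n u (us n)" for n
    unfolding idl_cong_def idl_def
  proof (clarify)
    fix w :: "nat list" assume "length w < n"
    then obtain d where "n = Suc (length w) + d" using less_iff_Suc_add by auto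
    then have "coef (us n) w = coef (us (Suc (length w))) w"
      using step[of "Suc (length w)" d] by (simp add: idl_def)
    then show "coef (u - us n) w = 0" by (simp add: u_def Abs_ncps_inverse)
  qed
  have "coef u [] = 1"
    using us(1)[of 1] by (simp add: u_def Abs_ncps_inverse approx_conj_def)
  moreover have "F (G (ncvar i)) * u = u * ncvar i" if i: "i < N" for i
  proof (rule idl_all_eq)
    fix n
    have "idl_cong n (F (G (ncvar i)) * u) (F (G (ncvar i)) * us n)" by (rule idl_cong_mult_left[OF u])
    also have "idl_cong n \<dots> (us n * ncvar i)"
      using us(1)[of n] i idl_cong_mono unfolding approx_conj_def by (metis le_SucI order_refl)
    also have "idl_cong n \<dots> (u * ncvar i)" by (rule idl_cong_mult_right[OF idl_cong_sym[OF u]])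
    finally show "F (G (ncvar i)) * u - u * ncvar i \<in> idl n" by (simp add: idl_cong_def)
  qed
  ultimately show ?thesis by blast
qed

end

section \<open>The Magnus representation\<close>

definition fw_flip :: "nat \<times> bool \<Rightarrow> nat \<times> bool" where
  "fw_flip x = (fst x, \<not> snd x)"

definition fw_inv :: "fword \<Rightarrow> fword" where
  "fw_inv w = rev (map fw_flip w)"

lemma fw_reduced_Nil [simp]: "fw_reduced []"
  and fw_reduced_single [simp]: "fw_reduced [x]"
  by (simp_all add: fw_reduced_def)

lemma fw_reduced_Cons_Cons [simp]:
  "fw_reduced (x # y # w) \<longleftrightarrow> y \<noteq> fw_flip x \<and> fw_reduced (y # w)"
proof -
  have *: "fst x = fst y \<and> snd x \<noteq> snd y \<longleftrightarrow> y = fw_flip x"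
    by (auto simp: fw_flip_def prod_eq_iff)
  show ?thesis
    unfolding fw_reduced_def using * by (auto simp: nth_Cons less_Suc_eq_0_disj split: nat.splits)
qed

lemma fw_cancel_Cons: "fw_cancel x (y # w) = (if y = fw_flip x then w else x # y # w)"
  by (auto simp: fw_flip_def prod_eq_iff)

lemma fw_flip_flip [simp]: "fw_flip (fw_flip x) = x"
  by (simp add: fw_flip_def)

lemma fw_reduced_tl: "fw_reduced (x # w) \<Longrightarrow> fw_reduced w"
  by (cases w) auto

lemma fw_reduced_cancel: "fw_reduced w \<Longrightarrow> fw_reduced (fw_cancel x w)"
  by (cases w) (auto simp: fw_cancel_Cons dest: fw_reduced_tl simp del: fw_cancel.simps(2))

text \<open>Van der Waerden's trick: letters act on reduced words through \<open>fw_cancel\<close>,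
  inverse letters acting as inverse permutations. Associativity then comes from composition of maps
  instead of confluence of cancellation.\<close>

lemma fw_cancel_flip: "fw_reduced w \<Longrightarrow> fw_cancel (fw_flip x) (fw_cancel x w) = w"
proof (cases w)
  case (Cons y v)
  then show "fw_reduced w \<Longrightarrow> ?thesis"
    by (cases v) (auto simp: fw_cancel_Cons simp del: fw_cancel.simps(2))
qed (simp add: fw_flip_def)

lemma fw_reduced_foldr: "fw_reduced r \<Longrightarrow> fw_reduced (foldr fw_cancel u r)"
  by (induction u) (auto intro: fw_reduced_cancel)

lemma fw_reduced_reduce: "fw_reduced (fw_reduce w)"
  by (simp add: fw_reduce_def fw_reduced_foldr)

lemma fw_reduce_reduced: "fw_reduced w \<Longrightarrow> fw_reduce w = w"
proof (induction w)
  case (Cons x w)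
  then have "fw_reduce (x # w) = fw_cancel x w" using fw_reduced_tl by (auto simp: fw_reduce_def)
  then show ?case using Cons.prems by (cases w) (auto simp: fw_cancel_Cons simp del: fw_cancel.simps(2))
qed (simp add: fw_reduce_def)

lemma fw_reduce_append: "fw_reduce (u @ v) = foldr fw_cancel u (fw_reduce v)"
  by (simp add: fw_reduce_def)

lemma foldr_cancel_cancel:
  assumes "fw_reduced r"
  shows "foldr fw_cancel (fw_cancel x u) r = fw_cancel x (foldr fw_cancel u r)"
proof (cases u)
  case (Cons y v)
  show ?thesis
  proof (cases "y = fw_flip x")
    case True
    then show ?thesis
      using fw_cancel_flip[OF fw_reduced_foldr[OF assms], of "fw_flip x" v]
      by (simp add: Cons fw_cancel_Cons del: fw_cancel.simps(2))
  qed (simp add: Cons fw_cancel_Cons del: fw_cancel.simps(2))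
qed simp

lemma foldr_cancel_reduce:
  "fw_reduced r \<Longrightarrow> foldr fw_cancel (fw_reduce u) r = foldr fw_cancel u r"
  by (induction u) (simp_all add: fw_reduce_def foldr_cancel_cancel)

lemma fw_reduce_append_left: "fw_reduce (fw_reduce u @ v) = fw_reduce (u @ v)"
  by (simp add: fw_reduce_append foldr_cancel_reduce fw_reduced_reduce)

lemma fw_reduce_append_right: "fw_reduce (u @ fw_reduce v) = fw_reduce (u @ v)"
  by (simp add: fw_reduce_append fw_reduce_reduced fw_reduced_reduce)

lemma fw_reduce_inv: "fw_reduce (fw_inv w @ w) = []"
proof (induction w)
  case (Cons x w)
  have "fw_reduce (fw_inv (x # w) @ x # w) = foldr fw_cancel (fw_inv w) (fw_cancel (fw_flip x) (fw_cancel x (fw_reduce w)))"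
    by (simp add: fw_inv_def fw_reduce_append) (simp add: fw_reduce_def)
  then show ?case using Cons by (simp add: fw_cancel_flip fw_reduced_reduce fw_reduce_append)
qed (simp add: fw_inv_def fw_reduce_def)

lemma set_fw_cancel: "set (fw_cancel x w) \<subseteq> insert x (set w)"
  by (cases w) auto

lemma set_fw_reduce: "set (fw_reduce w) \<subseteq> set w"
proof (induction w)
  case (Cons x w)
  then show ?case using set_fw_cancel[of x "fw_reduce w"] by (auto simp: fw_reduce_def)
qed (simp add: fw_reduce_def)

definition letters_below :: "nat \<Rightarrow> fword \<Rightarrow> bool" where
  "letters_below N w \<longleftrightarrow> (\<forall>x\<in>set w. fst x < N)"

lemma letters_below_simps [simp]:
  "letters_below N []"
  "letters_below N (x # w) \<longleftrightarrow> fst x < N \<and> letters_below N w"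
  "letters_below N (u @ w) \<longleftrightarrow> letters_below N u \<and> letters_below N w"
  "letters_below N (fw_inv w) \<longleftrightarrow> letters_below N w"
  by (auto simp: letters_below_def fw_inv_def fw_flip_def)

lemma letters_below_reduce: "letters_below N w \<Longrightarrow> letters_below N (fw_reduce w)"
  using set_fw_reduce by (auto simp: letters_below_def)

lemma carrier_free_grp: "w \<in> carrier (free_grp N) \<longleftrightarrow> fw_reduced w \<and> letters_below N w"
  by (simp add: free_grp_def letters_below_def)

lemma mult_free_grp: "u \<otimes>\<^bsub>free_grp N\<^esub> v = fw_reduce (u @ v)"
  and one_free_grp: "\<one>\<^bsub>free_grp N\<^esub> = []"
  by (simp_all add: free_grp_def)

lemma reduce_in_carrier: "letters_below N w \<Longrightarrow> fw_reduce w \<in> carrier (free_grp N)"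
  by (simp add: carrier_free_grp fw_reduced_reduce letters_below_reduce)

lemma group_free_grp: "group (free_grp N)"
proof (rule groupI)
  fix x y z assume "x \<in> carrier (free_grp N)" "y \<in> carrier (free_grp N)"
  then show "x \<otimes>\<^bsub>free_grp N\<^esub> y \<in> carrier (free_grp N)"
    by (simp add: mult_free_grp carrier_free_grp fw_reduced_reduce letters_below_reduce)
  show "x \<otimes>\<^bsub>free_grp N\<^esub> y \<otimes>\<^bsub>free_grp N\<^esub> z = x \<otimes>\<^bsub>free_grp N\<^esub> (y \<otimes>\<^bsub>free_grp N\<^esub> z)"
    by (simp add: mult_free_grp fw_reduce_append_left fw_reduce_append_right)
next
  show "\<one>\<^bsub>free_grp N\<^esub> \<in> carrier (free_grp N)" by (simp add: one_free_grp carrier_free_grp)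
next
  fix x assume x: "x \<in> carrier (free_grp N)"
  then show "\<one>\<^bsub>free_grp N\<^esub> \<otimes>\<^bsub>free_grp N\<^esub> x = x"
    by (simp add: one_free_grp mult_free_grp carrier_free_grp fw_reduce_reduced)
  show "\<exists>y\<in>carrier (free_grp N). y \<otimes>\<^bsub>free_grp N\<^esub> x = \<one>\<^bsub>free_grp N\<^esub>"
    using x by (intro bexI[of _ "fw_reduce (fw_inv x)"])
      (simp_all add: mult_free_grp one_free_grp fw_reduce_append_left fw_reduce_inv
        reduce_in_carrier carrier_free_grp fw_reduced_reduce letters_below_reduce)
qed

text \<open>Newton's series for (1 + X_i)^e, which treats letters, inverse letters and whole
  syllables uniformly.\<close>

lift_definition binom_series :: "'i \<Rightarrow> rat \<Rightarrow> ('i, rat) ncps"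
  is "\<lambda>i e s. if set s \<subseteq> {i} then e gchoose length s else 0" .

lemma coef_binom_series: "coef (binom_series i e) s = (if set s \<subseteq> {i} then e gchoose length s else 0)"
  by transfer simp

text \<open>On words in the single letter i this is Vandermonde's convolution.\<close>

lemma binom_series_add: "binom_series i a * binom_series i b = binom_series i (a + b)"
proof (rule ncps_eqI)
  fix w
  show "coef (binom_series i a * binom_series i b) w = coef (binom_series i (a + b)) w"
  proof (cases "set w \<subseteq> {i}")
    case True
    then have s: "set (take j w) \<subseteq> {i}" "set (drop j w) \<subseteq> {i}" for j
      using set_take_subset set_drop_subset by fastforce+
    have "coef (binom_series i a * binom_series i b) w = (\<Sum>j\<le>length w. (a gchoose j) * (b gchoose (length w - j)))"
      unfolding coef_mult by (intro sum.cong refl) (simp add: coef_binom_series s)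
    also have "\<dots> = (a + b) gchoose length w"
      using gbinomial_Vandermonde[of a b "length w"] by (simp add: atMost_atLeast0)
    finally show ?thesis using True by (simp add: coef_binom_series)
  next
    case False
    have "coef (binom_series i a) (take j w) * coef (binom_series i b) (drop j w) = 0" for j
    proof -
      have "set w = set (take j w) \<union> set (drop j w)" by (metis append_take_drop_id set_append)
      then show ?thesis using False by (auto simp: coef_binom_series)
    qed
    then have "coef (binom_series i a * binom_series i b) w = 0" unfolding coef_mult by (intro sum.neutral) blast
    then show ?thesis using False by (simp add: coef_binom_series)
  qed
qed

lemma binom_series_0 [simp]: "binom_series i 0 = 1"
proof (rule ncps_eqI)
  show "coef (binom_series i 0) w = coef 1 w" for w by (cases w) (simp_all add: coef_binom_series coef_one)
qed

lemma binom_series_1: "binom_series i 1 = 1 + ncvar i"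
proof (rule ncps_eqI)
  fix w
  show "coef (binom_series i 1) w = coef (1 + ncvar i) w"
  proof (cases w)
    case (Cons x v)
    have "(1::rat) gchoose Suc (Suc n) = 0" for n
      using binomial_gbinomial[of 1 "Suc (Suc n)", where ?'a = rat] by simp
    then show ?thesis by (cases v) (auto simp: Cons coef_binom_series coef_one coef_ncvar)
  qed (simp add: coef_binom_series coef_one coef_ncvar)
qed

lemma coef_binom_series_Nil [simp]: "coef (binom_series i e) [] = 1"
  by (simp add: coef_binom_series)

definition letter_sign :: "nat \<times> bool \<Rightarrow> int" where
  "letter_sign x = (if snd x then -1 else 1)"

definition letter_series :: "nat \<times> bool \<Rightarrow> series" where
  "letter_series x = binom_series (fst x) (of_int (letter_sign x))"

definition magnus :: "fword \<Rightarrow> series" where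
  "magnus w = prod_list (map letter_series w)"

lemma magnus_simps [simp]:
  "magnus [] = 1" "magnus (x # w) = letter_series x * magnus w" "magnus (u @ v) = magnus u * magnus v"
  by (simp_all add: magnus_def)

lemma magnus_generator: "magnus [(i, False)] = 1 + ncvar i"
  by (simp add: letter_series_def letter_sign_def binom_series_1)

lemma letter_series_flip: "letter_series x * letter_series (fw_flip x) = 1"
  by (simp add: letter_series_def fw_flip_def letter_sign_def binom_series_add)

lemma magnus_cancel: "magnus (fw_cancel x w) = letter_series x * magnus w"
proof (cases w)
  case (Cons y v)
  then show ?thesis
    using letter_series_flip[of x]
    by (simp add: fw_cancel_Cons mult.assoc[symmetric] del: fw_cancel.simps(2))
qed simp

lemma magnus_reduce [simp]: "magnus (fw_reduce w) = magnus w"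
  by (induction w) (simp_all add: fw_reduce_def magnus_cancel)

lemma magnus_inv: "magnus (fw_inv w) * magnus w = 1" "magnus w * magnus (fw_inv w) = 1"
proof -
  have 1: "magnus (fw_inv w) * magnus w = 1" for w
    using magnus_reduce[of "fw_inv w @ w"] by (simp add: fw_reduce_inv)
  have "fw_inv (fw_inv w) = w" by (simp add: fw_inv_def rev_map map_idI)
  then show "magnus (fw_inv w) * magnus w = 1" "magnus w * magnus (fw_inv w) = 1"
    using 1 by metis+
qed

lemma coef_magnus_Nil [simp]: "coef (magnus w) [] = 1"
  by (induction w) (simp_all add: coef_one letter_series_def)

text \<open>The linear part of the Magnus image is the homology class of the word; through it the
  hypothesis modulo 3 reaches the ring.\<close>

lemma coef_magnus_single: "coef (magnus w) [j] = of_int (expsum j w)"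
  by (induction w) (auto simp: coef_one expsum_def coef_mult letter_series_def coef_binom_series letter_sign_def)

lemma magnus_supported: "letters_below N w \<Longrightarrow> subst N ncvar (magnus w) = magnus w"
proof (induction w)
  case (Cons x w)
  have "subst N ncvar (letter_series x) = letter_series x"
    by (rule ncps_eqI) (use Cons.prems in \<open>auto simp: coef_subst_ncvar letter_series_def coef_binom_series\<close>)
  then show ?case using Cons by simp
qed simp

text \<open>Zero exponents and equal neighbouring indices are permitted, so that
  \<open>conj_generator\<close> can start from single letters and shorten the list.\<close>

definition syl_prod :: "(nat \<times> int) list \<Rightarrow> series" where
  "syl_prod L = prod_list (map (\<lambda>(i, e). binom_series i (of_int e)) L)"

lemma syl_prod_simps [simp]:
  "syl_prod [] = 1" "syl_prod ((i, e) # L) = binom_series i (of_int e) * syl_prod L"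
  "syl_prod (L @ M) = syl_prod L * syl_prod M"
  by (simp_all add: syl_prod_def)

text \<open>A monomial without repeated adjacent letters takes at most one letter from each syllable.\<close>

lemma coef_syl_prod:
  assumes "distinct_adj s" "length L \<le> length s"
  shows "coef (syl_prod L) s = (if s = map fst L then of_int (\<Prod>(i, e)\<leftarrow>L. e) else 0)"
  using assms
proof (induction L arbitrary: s)
  case Nil
  then show ?case by (simp add: coef_one)
next
  case (Cons p L)
  obtain i e where p: "p = (i, e)" by force
  obtain x t where s: "s = x # t" using Cons.prems by (cases s) auto
  have t: "distinct_adj t" using Cons.prems by (simp add: s distinct_adj_ConsD)
  have 0: "coef (syl_prod L) s = 0"
  proof -
    have "s \<noteq> map fst L" using Cons.prems by auto
    then show ?thesis using Cons.IH[of s] Cons.prems by simp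
  qed
  have "coef (binom_series i (of_int e)) (take j s) * coef (syl_prod L) (drop j s) =
     (if j = 1 then (if x = i then of_int e * coef (syl_prod L) t else 0) else 0)"
    if "j \<le> length s" for j
  proof -
    consider "j = 0" | "j = 1" | k where "j = Suc (Suc k)" by (metis One_nat_def nat.exhaust)
    then show ?thesis
    proof cases
      case 3
      show ?thesis
      proof (cases t)
        case Nil
        then show ?thesis using 3 s that by simp
      next
        case (Cons y t')
        then have "x \<noteq> y" using \<open>distinct_adj s\<close> s by simp
        then show ?thesis using 3 s Cons by (auto simp: coef_binom_series)
      qed
    qed (use s 0 in \<open>auto simp: coef_binom_series\<close>)
  qed
  then have "coef (syl_prod (p # L)) s =
      (\<Sum>j\<le>length s. if j = 1 then (if x = i then of_int e * coef (syl_prod L) t else 0) else 0)"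
    unfolding p syl_prod_simps coef_mult by (intro sum.cong refl) simp
  also have "\<dots> = (if x = i then of_int e * coef (syl_prod L) t else 0)"
    by (subst sum.delta) (simp_all add: s)
  finally show ?case using Cons.IH[OF t] Cons.prems s p by auto
qed

fun syllables :: "fword \<Rightarrow> (nat \<times> int) list" where
  "syllables [] = []"
| "syllables (x # w) = (case syllables w of
     [] \<Rightarrow> [(fst x, letter_sign x)]
   | (i, e) # L \<Rightarrow> if i = fst x then (i, e + letter_sign x) # L else (fst x, letter_sign x) # (i, e) # L)"

lemma syl_prod_syllables: "syl_prod (syllables w) = magnus w"
proof (induction w)
  case (Cons x w)
  have merge: "binom_series i (of_int (e + letter_sign x)) * a = binom_series i (of_int (letter_sign x)) * (binom_series i (of_int e) * a)"
    for i e a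
    by (simp add: binom_series_add add.commute mult.assoc[symmetric])
  show ?case
    unfolding magnus_simps Cons.IH[symmetric]
    by (auto simp: letter_series_def merge simp del: of_int_add split: list.split)
qed simp

text \<open>The last conjunct strengthens the induction: the leading exponent has the sign of the
  first letter, so merging a further letter of a reduced word never makes an exponent 0.\<close>

lemma syllables_reduced:
  assumes "fw_reduced w"
  shows "distinct_adj (map fst (syllables w)) \<and> (\<forall>p\<in>set (syllables w). snd p \<noteq> 0) \<and>
    (\<forall>x v. w = x # v \<longrightarrow> (\<exists>e L. syllables w = (fst x, e) # L \<and> e * letter_sign x > 0))"
  using assms
proof (induction w)
  case (Cons x w)
  note IH = Cons.IH[OF fw_reduced_tl[OF Cons.prems]]
  have sq: "letter_sign x * letter_sign x = 1" by (simp add: letter_sign_def)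
  show ?case
  proof (cases w)
    case Nil
    then show ?thesis by (simp add: sq letter_sign_def)
  next
    case (Cons y v)
    then obtain e L where eL: "syllables w = (fst y, e) # L" "e * letter_sign y > 0" using IH by blast
    show ?thesis
    proof (cases "fst y = fst x")
      case True
      then have "letter_sign y = letter_sign x"
        using Cons.prems Cons by (auto simp: fw_flip_def letter_sign_def prod_eq_iff)
      then have pos: "(e + letter_sign x) * letter_sign x > 0"
        using eL(2) by (simp add: distrib_right sq)
      then have "e + letter_sign x \<noteq> 0" by auto
      then show ?thesis using IH pos eL(1) True by auto
    next
      case False
      then show ?thesis using IH eL(1) by (auto simp: sq letter_sign_def)
    qed
  qed
qed simp

text \<open>At the monomial that lists the syllable indices, the coefficient is the product of the
  nonzero exponents.\<close>

lemma magnus_neq_one: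
  assumes "fw_reduced w" "w \<noteq> []" shows "magnus w \<noteq> 1"
proof
  assume one: "magnus w = 1"
  let ?L = "syllables w"
  have L: "distinct_adj (map fst ?L)" "\<forall>p\<in>set ?L. snd p \<noteq> 0" "?L \<noteq> []"
    using syllables_reduced[OF assms(1)] assms(2) by (auto simp: neq_Nil_conv)
  have "coef (syl_prod ?L) (map fst ?L) = of_int (\<Prod>(i, e)\<leftarrow>?L. e)"
    by (subst coef_syl_prod) (use L in auto)
  moreover have "(\<Prod>(i, e)\<leftarrow>?L. e) \<noteq> 0"
    using L(2) by (auto simp: prod_list_zero_iff)
  ultimately show False using one L(3) by (simp add: syl_prod_syllables coef_one)
qed

lemma magnus_inj:
  assumes "u \<in> carrier (free_grp N)" "v \<in> carrier (free_grp N)" "magnus u = magnus v"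
  shows "u = v"
proof -
  interpret group "free_grp N" by (rule group_free_grp)
  let ?w = "inv\<^bsub>free_grp N\<^esub> u \<otimes>\<^bsub>free_grp N\<^esub> v"
  have "magnus (inv\<^bsub>free_grp N\<^esub> u \<otimes>\<^bsub>free_grp N\<^esub> u) = 1"
    using assms by (simp add: one_free_grp)
  then have "magnus ?w = 1" using assms(3) by (simp add: mult_free_grp)
  moreover have "?w \<in> carrier (free_grp N)" using assms by simp
  ultimately have "?w = \<one>\<^bsub>free_grp N\<^esub>"
    using magnus_neq_one unfolding carrier_free_grp one_free_grp by blast
  then show ?thesis using assms by (metis inv_equality inv_inv inv_closed)
qed

text \<open>Rotations are counted with multiplicity, so periodic words need no separate treatment.
  The trace property proved below makes the value invariant under conjugation.\<close>

definition cyc_trace :: "'i list \<Rightarrow> ('i, 'a::comm_ring_1) ncps \<Rightarrow> 'a" where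
  "cyc_trace s a = (\<Sum>j<length s. coef a (rotate j s))"

lemma sum_rotate_shift:
  fixes h :: "'i list \<Rightarrow> 'a::ab_group_add"
  shows "(\<Sum>j<length s. h (rotate (j + i) s)) = (\<Sum>j<length s. h (rotate j s))"
proof (induction i)
  case (Suc i)
  have "(\<Sum>j<length s. h (rotate (j + Suc i) s)) + h (rotate i s) =
     (\<Sum>j<Suc (length s). h (rotate (j + i) s))"
    by (simp only: sum.lessThan_Suc_shift) (simp add: add.commute)
  also have "\<dots> = (\<Sum>j<length s. h (rotate (j + i) s)) + h (rotate i s)"
    by (simp add: rotate_conv_mod[of "length s + i"] rotate_conv_mod[of i s, symmetric])
  finally show ?case using Suc by simp
qed simp

lemma cyc_trace_commute: "cyc_trace s (a * b) = cyc_trace s (b * a)"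
proof -
  let ?n = "length s"
  have "cyc_trace s (a * b) = (\<Sum>i\<le>?n. \<Sum>j<?n. coef a (take i (rotate j s)) * coef b (drop i (rotate j s)))"
    unfolding cyc_trace_def coef_mult by (simp add: sum.swap[of _ "{..<?n}"])
  also have "\<dots> = (\<Sum>i\<le>?n. \<Sum>j<?n. coef b (take (?n - i) (rotate (j + i) s)) * coef a (drop (?n - i) (rotate (j + i) s)))"
  proof (intro sum.cong refl)
    fix i j assume "i \<in> {..?n}"
    \<comment> \<open>Cutting the j-th rotation after i letters and exchanging the pieces gives
      rotation j + i, cut after n - i letters, where n is the length of s.\<close>
    then have "rotate (j + i) s = drop i (rotate j s) @ take i (rotate j s)"
      using rotate_drop_take[of i "rotate j s"]
      by (cases "i = ?n") (auto simp: rotate_rotate add.commute)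
    then show "coef a (take i (rotate j s)) * coef b (drop i (rotate j s)) =
        coef b (take (?n - i) (rotate (j + i) s)) * coef a (drop (?n - i) (rotate (j + i) s))"
      by (simp add: mult.commute)
  qed
  also have "\<dots> = (\<Sum>i\<le>?n. \<Sum>j<?n. coef b (take (?n - i) (rotate j s)) * coef a (drop (?n - i) (rotate j s)))"
    by (intro sum.cong refl sum_rotate_shift)
  also have "\<dots> = (\<Sum>i\<le>?n. \<Sum>j<?n. coef b (take i (rotate j s)) * coef a (drop i (rotate j s)))"
    by (rule sum.reindex_bij_witness[of _ "\<lambda>i. ?n - i" "\<lambda>i. ?n - i"]) auto
  also have "\<dots> = cyc_trace s (b * a)"
    unfolding cyc_trace_def coef_mult by (simp add: sum.swap[of _ "{..<?n}"])
  finally show ?thesis .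
qed

section \<open>Words conjugate to generators\<close>

lemma not_distinct_adj_map:
  "\<not> distinct_adj (map h L) \<Longrightarrow> \<exists>A p q B. L = A @ p # q # B \<and> h p = h q"
proof (induction L)
  case (Cons p L)
  show ?case
  proof (cases "distinct_adj (map h L)")
    case False
    then obtain A p' q B where "L = A @ p' # q # B" "h p' = h q" using Cons.IH by blast
    then have "p # L = (p # A) @ p' # q # B \<and> h p' = h q" by simp
    then show ?thesis by blast
  next
    case True
    then obtain q B where "L = q # B" "h p = h q" using Cons.prems by (cases L) auto
    then have "p # L = [] @ p # q # B \<and> h p = h q" by simp
    then show ?thesis by blast
  qed
qed simp

text \<open>The condition on the two ends is the one adjacency of the cyclic word that the linear
  word does not see.\<close>

lemma distinct_adj_rotate:
  assumes "distinct_adj s" "2 \<le> length s" "hd s \<noteq> last s"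
  shows "distinct_adj (rotate j s)"
proof -
  have "distinct_adj (rotate j s) \<and> hd (rotate j s) \<noteq> last (rotate j s)"
  proof (induction j)
    case (Suc j)
    have len: "2 \<le> length (rotate j s)" using assms by simp
    then obtain x y t where r: "rotate j s = x # y # t"
      by (metis Suc_le_length_iff numeral_2_eq_2)
    then have "rotate (Suc j) s = (y # t) @ [x]" by simp
    then show ?case using Suc r by (auto simp: distinct_adj_append_iff simp del: append_Cons split: if_splits)
  qed (use assms in simp)
  then show ?thesis by simp
qed

definition word_pow :: "nat \<Rightarrow> int \<Rightarrow> fword" where
  "word_pow i e = replicate (nat \<bar>e\<bar>) (i, e < 0)"

lemma magnus_word_pow: "magnus (word_pow i e) = binom_series i (of_int e)"
proof -
  have "magnus (replicate n (i, b)) = binom_series i (of_int (int n * letter_sign (i, b)))" for n b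
    by (induction n) (simp_all add: letter_series_def binom_series_add algebra_simps)
  then show ?thesis by (simp add: word_pow_def letter_sign_def)
qed

lemma letters_below_word_pow: "i < N \<Longrightarrow> letters_below N (word_pow i e)"
  by (auto simp: word_pow_def letters_below_def)

text \<open>Conjugating to a product of as few syllables as possible makes it cyclically reduced;
  then a cyclic trace at its syllable monomial separates it from a generator.\<close>

lemma conj_generator:
  assumes w: "letters_below N w" and u: "coef u [] = 1" "magnus w * u = u * (1 + ncvar i)"
  shows "\<exists>z. letters_below N z \<and> magnus w * magnus z = magnus z * (1 + ncvar i)"
proof -
  \<comment> \<open>z is a word recording the conjugation performed so far, and L is the current
    syllable form of the conjugate of w.\<close>
  define good where "good = (\<lambda>L z. letters_below N z \<and> (\<forall>p\<in>set L. fst p < N) \<and>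
    magnus w * magnus z = magnus z * syl_prod L)"
  have "syl_prod (map (\<lambda>x. (fst x, letter_sign x)) w) = magnus w" for w
    by (induction w) (simp_all add: letter_series_def)
  then have "good (map (\<lambda>x. (fst x, letter_sign x)) w) []"
    using w by (auto simp: good_def letters_below_def)
  then have "\<exists>L. \<exists>z. good L z" by blast
  then obtain L where L: "\<exists>z. good L z" and min: "\<And>L'. \<exists>z. good L' z \<Longrightarrow> length L \<le> length L'"
    using ex_has_least_nat[of "\<lambda>L. \<exists>z. good L z" _ length] by blast
  obtain z where z: "good L z" using L by blast
  have nonzero: "snd p \<noteq> 0" if p: "p \<in> set L" for p
  proof
    assume p0: "snd p = 0"
    obtain A B where AB: "L = A @ p # B" using p by (meson split_list)
    have "syl_prod L = syl_prod (A @ B)" unfolding AB using p0 by (cases p) simp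
    then have "good (A @ B) z" using z AB by (auto simp: good_def)
    then show False using min[of "A @ B"] AB by auto
  qed
  have adj: "distinct_adj (map fst L)"
  proof (rule ccontr)
    assume "\<not> distinct_adj (map fst L)"
    then obtain A p q B where AB: "L = A @ p # q # B" "fst p = fst q" using not_distinct_adj_map by blast
    let ?L = "A @ (fst p, snd p + snd q) # B"
    have "syl_prod L = syl_prod ?L"
      unfolding AB(1) using AB(2)
      by (cases p; cases q) (simp add: binom_series_add[symmetric] mult.assoc)
    then have "good ?L z" using z AB by (auto simp: good_def)
    then show False using min[of ?L] AB by auto
  qed
  have cyc: "fst (hd L) \<noteq> fst (last L)" if len: "2 \<le> length L"
  proof
    assume eq: "fst (hd L) = fst (last L)"
    obtain p M q where L': "L = p # M @ [q]"
      using len by (metis One_nat_def Suc_1 Suc_le_length_iff append_butlast_last_id list.discI)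
    then have pq: "fst p = fst q" using eq by simp
    obtain j a b where jab: "p = (j, a)" "q = (j, b)" using pq by (metis prod.collapse)
    \<comment> \<open>Conjugating by the last syllable carries it to the front, where it merges with
      the first one.\<close>
    let ?L = "(j, b + a) # M" and ?z = "z @ word_pow j (- b)"
    have j: "j < N" using z L' jab by (auto simp: good_def)
    have one: "binom_series j (of_int b) * binom_series j (- of_int b) = 1" "binom_series j (- of_int b) * binom_series j (of_int b) = 1"
      by (simp_all add: binom_series_add)
    have "magnus w * magnus ?z = magnus z * syl_prod L * binom_series j (- of_int b)"
      using z by (simp add: good_def magnus_word_pow mult.assoc[symmetric])
    also have "\<dots> = magnus z * (binom_series j (of_int a) * syl_prod M)"
      using one(1) by (simp add: L' jab mult.assoc)
    also have "\<dots> = magnus z * (binom_series j (- of_int b) * binom_series j (of_int b)) * (binom_series j (of_int a) * syl_prod M)"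
      by (simp add: one(2))
    also have "\<dots> = magnus ?z * syl_prod ?L"
      by (simp add: magnus_word_pow binom_series_add[symmetric] mult.assoc)
    finally have "good ?L ?z" using z L' jab j by (auto simp: good_def letters_below_word_pow)
    then have "length L \<le> length ?L" using min by blast
    then show False using L' by simp
  qed
  \<comment> \<open>v conjugates the shortened product to 1 + X_i, so the two have equal cyclic
    traces.\<close>
  define v where "v = magnus (fw_inv z) * u"
  have v1: "coef v [] = 1" using u by (simp add: v_def)
  obtain v' where v': "v * v' = 1" "v' * v = 1" using inverse_exists[OF v1] by blast
  have zL: "magnus z * syl_prod L = magnus w * magnus z" using z by (simp add: good_def)
  have "syl_prod L * v = magnus (fw_inv z) * (magnus z * syl_prod L) * (magnus (fw_inv z) * u)"
    using magnus_inv(1)[of z] by (simp add: v_def mult.assoc[symmetric])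
  also have "\<dots> = magnus (fw_inv z) * (magnus w * (magnus z * magnus (fw_inv z)) * u)"
    unfolding zL by (simp only: mult.assoc)
  also have "\<dots> = v * (1 + ncvar i)"
    by (simp add: magnus_inv u(2) v_def mult.assoc)
  finally have conj: "syl_prod L = v * ((1 + ncvar i) * v')"
    using v' by (metis mult.assoc mult.right_neutral)
  have trace: "cyc_trace s (syl_prod L) = cyc_trace s (1 + ncvar i)" for s
    unfolding conj cyc_trace_commute[of s v] using v'(2) by (simp add: mult.assoc)
  have tr1: "cyc_trace [i] (1 + ncvar i :: series) = 1"
    by (simp add: cyc_trace_def coef_one coef_ncvar)
  consider "L = []" | p where "L = [p]" | "2 \<le> length L"
    by (metis One_nat_def Suc_1 Suc_leI length_0_conv length_Suc_conv nat_less_le not_less_eq_eq zero_le le_SucE not_le)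
  then show ?thesis
  proof cases
    case 1
    then show ?thesis using trace[of "[i]"] tr1 by (simp add: cyc_trace_def coef_one)
  next
    case 2
    obtain j e where p: "p = (j, e)" by force
    have "coef (binom_series j (of_int e)) [i] = 1"
      using trace[of "[i]"] by (simp add: 2 p cyc_trace_def coef_one coef_ncvar)
    then have "i = j" "e = 1" by (auto simp: coef_binom_series split: if_splits)
    then show ?thesis using z by (auto simp: good_def 2 p binom_series_1)
  next
    case 3
    let ?s = "map fst L" and ?P = "of_int (\<Prod>(i, e)\<leftarrow>L. e) :: rat"
    have "hd ?s \<noteq> last ?s" using cyc[OF 3] 3 by (cases L) (auto simp: last_map hd_map)
    then have rot: "distinct_adj (rotate j ?s)" for j using distinct_adj_rotate[OF adj] 3 by simp
    \<comment> \<open>Only rotations fixing the syllable monomial contribute, each with the product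
      of the exponents, and the trivial rotation is among them; 1 + X_i has no term of length 2 or
      more.\<close>
    have "cyc_trace ?s (syl_prod L) = (\<Sum>j<length ?s. if rotate j ?s = ?s then ?P else 0)"
      unfolding cyc_trace_def by (intro sum.cong refl) (simp add: coef_syl_prod[OF rot])
    also have "\<dots> = (\<Sum>j<length ?s. if rotate j ?s = ?s then 1 else 0) * ?P"
      unfolding sum_distrib_right by (intro sum.cong refl) simp
    also have "\<dots> \<noteq> 0"
    proof -
      have "(\<Sum>j<length ?s. if rotate j ?s = ?s then 1 else 0 :: rat) \<ge> (\<Sum>j\<in>{0}. if rotate j ?s = ?s then 1 else 0)"
        by (rule sum_mono2) (use 3 in auto)
      moreover have "(\<Prod>(i, e)\<leftarrow>L. e) \<noteq> 0" using nonzero by (fastforce simp: prod_list_zero_iff)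
      ultimately show ?thesis by auto
    qed
    also have "cyc_trace ?s (syl_prod L) = 0"
    proof -
      have "coef (1 + ncvar i :: series) (rotate j ?s) = 0" for j
      proof -
        have "length (rotate j ?s) \<ge> 2" using 3 by simp
        then show ?thesis by (cases "rotate j ?s") (auto simp: coef_one coef_ncvar)
      qed
      then show ?thesis unfolding trace by (simp add: cyc_trace_def)
    qed
    finally show ?thesis by simp
  qed
qed

text \<open>Comparing both products at a word ending in i shows that moving a leading i to the end
  preserves the coefficient of p. A word with a letter x other than i is thus brought to one
  starting with x, where X_i p contributes nothing.\<close>

lemma centralizer_ncvar:
  fixes p :: "('i, 'a::comm_ring_1) ncps"
  assumes comm: "p * ncvar i = ncvar i * p" and t: "coef p t \<noteq> 0"
  shows "set t \<subseteq> {i}"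
proof (rule ccontr)
  have vanish: "coef p (replicate n i @ x # s) = 0" if "x \<noteq> i" for n x s
  proof (induction n arbitrary: s)
    case 0
    have "coef p (x # s) = coef (p * ncvar i) ((x # s) @ [i])"
      by (subst coef_mult_ncvar_snoc) simp
    also have "\<dots> = 0" using that unfolding comm by (simp add: coef_ncvar_mult_Cons)
    finally show ?case by simp
  next
    case (Suc n)
    have "coef p (replicate (Suc n) i @ x # s) = coef (p * ncvar i) ((replicate (Suc n) i @ x # s) @ [i])"
      by (subst coef_mult_ncvar_snoc) simp
    also have "\<dots> = coef p (replicate n i @ x # (s @ [i]))"
      unfolding comm by (simp add: coef_ncvar_mult_Cons)
    finally show ?case using Suc by simp
  qed
  assume "\<not> set t \<subseteq> {i}"
  then obtain x s where d: "dropWhile (\<lambda>x. x = i) t = x # s" "x \<noteq> i"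
    by (metis (mono_tags, lifting) dropWhile_eq_Nil_conv dropWhile_eq_Cons_conv list.exhaust singleton_iff subsetI)
  have "takeWhile (\<lambda>x. x = i) t = replicate (length (takeWhile (\<lambda>x. x = i) t)) i"
    by (metis (full_types) replicate_length_same set_takeWhileD)
  then have "t = replicate (length (takeWhile (\<lambda>x. x = i) t)) i @ x # s"
    using d(1) by (metis takeWhile_dropWhile_id)
  then show False using vanish[OF d(2)] t by metis
qed

section \<open>Setting variables to 0\<close>

lemma subst_projection: "substitution N (\<lambda>i. if i \<in> A then ncvar i else 0)"
  by unfold_locales (simp add: ncvar_idl del: One_nat_def)

lemma coef_subst_projection:
  "coef (subst N (\<lambda>i. if i \<in> A then ncvar i else 0) a) w = (if set w \<subseteq> A \<inter> {..<N} then coef a w else 0)"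
proof (induction w arbitrary: a)
  case Nil
  show ?case by (simp add: substitution.coef_subst_Nil[OF subst_projection])
next
  case (Cons x w)
  let ?\<pi> = "subst N (\<lambda>i. if i \<in> A then ncvar i else 0)"
  have rec: "?\<pi> a = const (coef a []) + (\<Sum>i<N. (if i \<in> A then ncvar i else 0) * ?\<pi> (lder i a))"
    by (rule substitution.subst_rec[OF subst_projection])
  have "coef (?\<pi> a) (x # w) = (\<Sum>i<N. coef ((if i \<in> A then ncvar i else 0) * ?\<pi> (lder i a)) (x # w))"
    by (subst rec) (simp add: coef_const)
  also have "\<dots> = (\<Sum>i<N. if x = i then (if x \<in> A then coef (?\<pi> (lder x a)) w else 0) else 0)"
    by (intro sum.cong refl) (simp add: coef_ncvar_mult_Cons)
  finally show ?case using Cons by auto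
qed

lemma magnus_projection:
  assumes "letters_below N w"
  shows "subst N (\<lambda>i. if i \<in> A then ncvar i else 0) (magnus w) = magnus (filter (\<lambda>x. fst x \<in> A) w)"
  using assms
proof (induction w)
  case Nil
  show ?case by (simp add: substitution.subst_one[OF subst_projection])
next
  case (Cons x w)
  have "subst N (\<lambda>i. if i \<in> A then ncvar i else 0) (letter_series x) = (if fst x \<in> A then letter_series x else 1)"
  proof (rule ncps_eqI)
    fix t
    show "coef (subst N (\<lambda>i. if i \<in> A then ncvar i else 0) (letter_series x)) t =
        coef (if fst x \<in> A then letter_series x else 1) t"
      using Cons.prems by (cases t) (auto simp: coef_subst_projection letter_series_def coef_binom_series coef_one)
  qed
  then show ?case using Cons by (simp add: substitution.subst_mult[OF subst_projection])
qed

lemma conj_series_is_word: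
  assumes N: "2 \<le> N" and w: "\<And>i. i < N \<Longrightarrow> letters_below N (w i)"
    and u: "coef u [] = 1" "\<And>i. i < N \<Longrightarrow> magnus (w i) * u = u * (1 + ncvar i)"
  shows "\<exists>z. letters_below N z \<and> magnus z = u"
proof -
  have "\<exists>z. letters_below N z \<and> (magnus (fw_inv z) * u) * ncvar i = ncvar i * (magnus (fw_inv z) * u)"
    if i: "i < N" for i
  proof -
    obtain z where z: "letters_below N z" "magnus (w i) * magnus z = magnus z * (1 + ncvar i)"
      using conj_generator[OF w[OF i] u(1) u(2)[OF i]] by blast
    have "(1 + ncvar i) * magnus (fw_inv z) = magnus (fw_inv z) * (magnus z * (1 + ncvar i)) * magnus (fw_inv z)"
      using magnus_inv(1)[of z] by (simp add: mult.assoc[symmetric])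
    also have "\<dots> = magnus (fw_inv z) * magnus (w i)"
      unfolding z(2)[symmetric] using magnus_inv(2)[of z] by (simp add: mult.assoc)
    finally have "(1 + ncvar i) * (magnus (fw_inv z) * u) = magnus (fw_inv z) * u * (1 + ncvar i)"
      using u(2)[OF i] by (metis mult.assoc)
    then have "magnus (fw_inv z) * u * ncvar i = ncvar i * (magnus (fw_inv z) * u)"
      by (simp add: distrib_left distrib_right)
    then show ?thesis using z(1) by blast
  qed
  from this[of 0] this[of 1] N obtain z0 z1 where z: "letters_below N z0" "letters_below N z1"
    and comm: "(magnus (fw_inv z0) * u) * ncvar 0 = ncvar 0 * (magnus (fw_inv z0) * u)"
      "(magnus (fw_inv z1) * u) * ncvar 1 = ncvar 1 * (magnus (fw_inv z1) * u)"
    by auto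
  define p where "p = magnus (fw_inv z0) * u"
  define q where "q = magnus (fw_inv z1) * u"
  \<comment> \<open>Every variable but X_0 is killed: p, a series in X_0, is fixed, and q, a series
    in X_1, becomes its constant term 1. Applied to p = z0^(-1) z1 q this exhibits p as the image of
    a word.\<close>
  let ?\<pi> = "subst N (\<lambda>i. if i \<in> {0} then ncvar i else 0)"
  have pp: "?\<pi> p = p"
    by (rule ncps_eqI, unfold coef_subst_projection)
      (use N centralizer_ncvar[OF comm(1)] in \<open>auto simp: p_def\<close>)
  have qq: "?\<pi> q = 1"
  proof (rule ncps_eqI)
    fix t
    have "coef q t = 0" if "set t \<subseteq> {0}" "t \<noteq> []"
      using centralizer_ncvar[OF comm(2), of t] that by (cases t) (auto simp: q_def)
    moreover have "coef q [] = 1" using u by (simp add: q_def)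
    ultimately show "coef (?\<pi> q) t = coef 1 t"
      unfolding coef_subst_projection coef_one by (cases "t = []") auto
  qed
  have pq: "p = magnus (fw_inv z0 @ z1) * q"
  proof -
    have "magnus (fw_inv z0 @ z1) * q = magnus (fw_inv z0) * ((magnus z1 * magnus (fw_inv z1)) * u)"
      by (simp add: q_def mult.assoc)
    then show ?thesis by (simp add: magnus_inv p_def)
  qed
  have "?\<pi> p = ?\<pi> (magnus (fw_inv z0 @ z1)) * ?\<pi> q"
    unfolding substitution.subst_mult[OF subst_projection, symmetric] pq[symmetric] ..
  then have "p = ?\<pi> (magnus (fw_inv z0 @ z1))" unfolding pp qq by simp
  then have p: "p = magnus (filter (\<lambda>x. fst x \<in> {0}) (fw_inv z0 @ z1))"
    using magnus_projection[of N "fw_inv z0 @ z1" "{0}"] z by simp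
  have "u = magnus z0 * p" using magnus_inv(2)[of z0] by (simp add: p_def mult.assoc[symmetric])
  then have "u = magnus (z0 @ filter (\<lambda>x. fst x \<in> {0}) (fw_inv z0 @ z1))" unfolding p by simp
  moreover have "letters_below N (z0 @ filter (\<lambda>x. fst x \<in> {0}) (fw_inv z0 @ z1))"
    using z N by (auto simp: letters_below_def)
  ultimately show ?thesis by metis
qed

section \<open>Automorphisms of the free group\<close>

abbreviation "gen i \<equiv> [(i, False)] :: fword"

text \<open>Putting this for X_i sends 1 + X_i, the image of x_i, to the image of f (x_i).\<close>

definition aut_series :: "(fword \<Rightarrow> fword) \<Rightarrow> nat \<Rightarrow> series" where
  "aut_series f i = magnus (f (gen i)) - 1"

lemma gen_carrier: "i < N \<Longrightarrow> gen i \<in> carrier (free_grp N)"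
  by (simp add: carrier_free_grp)

lemma magnus_mult: "magnus (u \<otimes>\<^bsub>free_grp N\<^esub> v) = magnus u * magnus v"
  by (simp add: mult_free_grp)

lemma magnus_inv_free_grp:
  assumes "z \<in> carrier (free_grp N)"
  shows "magnus z * magnus (inv\<^bsub>free_grp N\<^esub> z) = 1" "magnus (inv\<^bsub>free_grp N\<^esub> z) * magnus z = 1"
proof -
  interpret group "free_grp N" by (rule group_free_grp)
  have "magnus (z \<otimes>\<^bsub>free_grp N\<^esub> inv\<^bsub>free_grp N\<^esub> z) = magnus []"
    "magnus (inv\<^bsub>free_grp N\<^esub> z \<otimes>\<^bsub>free_grp N\<^esub> z) = magnus []"
    using r_inv[OF assms] l_inv[OF assms] by (simp_all only: one_free_grp)
  then show "magnus z * magnus (inv\<^bsub>free_grp N\<^esub> z) = 1" "magnus (inv\<^bsub>free_grp N\<^esub> z) * magnus z = 1"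
    by (simp_all only: magnus_mult magnus_simps)
qed

lemma substitution_aut_series: "substitution N (aut_series f)"
  by unfold_locales (simp add: idl_1_iff aut_series_def coef_one del: One_nat_def)

lemma left_right_inverse_eq: "a * b = 1 \<Longrightarrow> b * c = 1 \<Longrightarrow> a = (c :: 'a::monoid_mult)"
  by (metis mult.assoc mult.left_neutral mult.right_neutral)

lemma subst_aut_series_magnus:
  assumes f: "f \<in> hom (free_grp N) (free_grp N)" and w: "w \<in> carrier (free_grp N)"
  shows "subst N (aut_series f) (magnus w) = magnus (f w)"
proof -
  interpret group "free_grp N" by (rule group_free_grp)
  interpret substitution N "aut_series f" by (rule substitution_aut_series)
  have f_mult: "magnus (f (u \<otimes>\<^bsub>free_grp N\<^esub> v)) = magnus (f u) * magnus (f v)"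
    if "u \<in> carrier (free_grp N)" "v \<in> carrier (free_grp N)" for u v
    using hom_mult[OF f that] by (simp add: magnus_mult)
  have f_one: "f [] = []"
    using hom_one[OF f is_group is_group] by (simp add: one_free_grp)
  have letter: "subst N (aut_series f) (letter_series x) = magnus (f [x])" if x: "fst x < N" for x
  proof -
    let ?i = "fst x"
    have pos: "subst N (aut_series f) (letter_series (?i, False)) = magnus (f (gen ?i))"
      using x by (simp add: letter_series_def letter_sign_def binom_series_1 aut_series_def)
    show ?thesis
    proof (cases "snd x")
      case False
      then show ?thesis using pos by (metis prod.collapse)
    next
      case True
      then have xe: "x = (?i, True)" by (metis prod.collapse)
      have "letter_series (?i, True) * letter_series (?i, False) = 1"
        using letter_series_flip[of "(?i, True)"] by (simp add: fw_flip_def)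
      then have 1: "subst N (aut_series f) (letter_series (?i, True)) * magnus (f (gen ?i)) = 1"
        unfolding pos[symmetric] subst_mult[symmetric] by simp
      have "gen ?i \<otimes>\<^bsub>free_grp N\<^esub> [(?i, True)] = []"
        by (simp add: mult_free_grp fw_reduce_def)
      then have 2: "magnus (f (gen ?i)) * magnus (f [(?i, True)]) = 1"
        using f_mult[of "gen ?i" "[(?i, True)]"] x f_one by (simp add: carrier_free_grp)
      \<comment> \<open>For an inverse letter, the substituted series is a left inverse and the
        image of its value under f a right inverse of the same series.\<close>
      have "subst N (aut_series f) (letter_series (?i, True)) = magnus (f [(?i, True)])"
        by (rule left_right_inverse_eq[OF 1 2])
      then show ?thesis using xe by metis
    qed
  qed
  show ?thesis using w
  proof (induction w)
    case (Cons x w)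
    then have xw: "[x] \<in> carrier (free_grp N)" "w \<in> carrier (free_grp N)"
      by (auto simp: carrier_free_grp dest: fw_reduced_tl)
    have "x # w = [x] \<otimes>\<^bsub>free_grp N\<^esub> w"
      using fw_reduce_reduced[of "x # w"] Cons.prems by (simp add: mult_free_grp carrier_free_grp)
    then have "magnus (f (x # w)) = magnus (f [x]) * magnus (f w)" using f_mult[OF xw] by simp
    then show ?case using Cons.IH xw letter[of x] by (simp add: carrier_free_grp)
  qed (simp add: f_one)
qed

section \<open>The action on homology modulo 3\<close>

lemma expsum_outside: "letters_below N w \<Longrightarrow> \<not> j < N \<Longrightarrow> expsum j w = 0"
  by (induction w) (auto simp: expsum_def)

definition acts_trivially_mod_3 :: "nat \<Rightarrow> (fword \<Rightarrow> fword) \<Rightarrow> bool" where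
  "acts_trivially_mod_3 N f \<longleftrightarrow>
     (\<forall>i<N. \<forall>j<N. expsum j (f [(i, False)]) mod 3 = (if i = j then 1 else 0))"

lemma hom_carrier_mem: "f \<in> hom G G \<Longrightarrow> x \<in> carrier G \<Longrightarrow> f x \<in> carrier G"
  by (auto simp: hom_def)

lemma cong3_of_int: "a mod 3 = b mod 3 \<Longrightarrow> cong3 (of_int a) (of_int b)"
proof -
  assume "a mod 3 = b mod 3"
  then obtain q where "a - b = 3 * q" by (metis mod_eq_dvd_iff dvdE)
  then have "(of_int (a - b) :: rat) = of_int (3 * q)" by (simp only:)
  then show ?thesis unfolding cong3_def by (intro exI[of _ q]) simp
qed

lemma substitution_mod_3_aut_series:
  assumes f: "f \<in> hom (free_grp N) (free_grp N)" and triv: "acts_trivially_mod_3 N f"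
  shows "substitution_mod_3 N (aut_series f)"
proof -
  interpret substitution N "aut_series f" by (rule substitution_aut_series)
  show ?thesis
  proof
    fix i assume i: "i < N"
    have fi: "f (gen i) \<in> carrier (free_grp N)" by (rule hom_carrier_mem[OF f gen_carrier[OF i]])
    then show "subst N ncvar (aut_series f i) = aut_series f i"
      by (simp add: aut_series_def magnus_supported carrier_free_grp)
    show "cong3 (coef (aut_series f i) [j]) (if i = j then 1 else 0)" for j
    proof -
      have c: "coef (aut_series f i) [j] = of_int (expsum j (f (gen i)))"
        by (simp add: aut_series_def coef_magnus_single coef_one)
      have "expsum j (f (gen i)) mod 3 = (if i = j then 1 else 0)"
      proof (cases "j < N")
        case True
        then show ?thesis using triv i by (simp add: acts_trivially_mod_3_def)
      next
        case False
        then show ?thesis using expsum_outside[of N "f (gen i)" j] fi i by (auto simp: carrier_free_grp)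
      qed
      then have "expsum j (f (gen i)) mod 3 = (if i = j then 1 else 0) mod 3" by simp
      from cong3_of_int[OF this] show ?thesis unfolding c by (simp split: if_splits)
    qed
  qed
qed

text \<open>Comparing linear coefficients in \<open>subst_aut_series_magnus\<close> gives this
  directly, since substitution acts on them by a matrix.\<close>

lemma expsum_hom:
  assumes f: "f \<in> hom (free_grp N) (free_grp N)" and w: "w \<in> carrier (free_grp N)"
  shows "expsum l (f w) = (\<Sum>j<N. expsum l (f (gen j)) * expsum j w)"
proof -
  interpret substitution N "aut_series f" by (rule substitution_aut_series)
  have "(of_int (expsum l (f w)) :: rat) = coef (subst N (aut_series f) (magnus w)) [l]"
    by (simp add: subst_aut_series_magnus[OF f w] coef_magnus_single)
  also have "\<dots> = (\<Sum>j<N. coef (aut_series f j * subst N (aut_series f) (lder j (magnus w))) ([l] @ []))"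
    by (subst subst_rec) (simp add: coef_one)
  also have "\<dots> = (\<Sum>j<N. coef (aut_series f j) [l] * coef (subst N (aut_series f) (lder j (magnus w))) [])"
    by (intro sum.cong refl coef_mult_lead) (use y in auto)
  also have "\<dots> = of_int (\<Sum>j<N. expsum l (f (gen j)) * expsum j w)"
    by (simp add: aut_series_def coef_magnus_single coef_one)
  finally show ?thesis unfolding of_int_eq_iff .
qed

text \<open>On homology the matrices of f and g multiply to the identity, so a first factor that is
  the identity modulo 3 forces the second to be so too.\<close>

lemma acts_trivially_inverse:
  assumes f: "f \<in> hom (free_grp N) (free_grp N)" "g \<in> hom (free_grp N) (free_grp N)"
    and inverse: "\<And>x. x \<in> carrier (free_grp N) \<Longrightarrow> f (g x) = x" and triv: "acts_trivially_mod_3 N f"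
  shows "acts_trivially_mod_3 N g"
  unfolding acts_trivially_mod_3_def
proof (intro allI impI)
  fix i l assume i: "i < N" and l: "l < N"
  have "expsum l (gen i) = (\<Sum>j<N. expsum l (f (gen j)) * expsum j (g (gen i)))"
    using expsum_hom[OF f(1) hom_carrier_mem[OF f(2) gen_carrier[OF i]], of l] inverse[OF gen_carrier[OF i]]
    by simp
  moreover have "expsum l (gen i) = (if i = l then 1 else 0)" by (simp add: expsum_def)
  ultimately have "(if i = l then 1 else 0) mod 3 = (\<Sum>j<N. expsum l (f (gen j)) * expsum j (g (gen i))) mod 3"
    by (simp only:)
  also have "\<dots> = (\<Sum>j<N. expsum l (f (gen j)) mod 3 * expsum j (g (gen i)) mod 3) mod 3"
    by (simp only: mod_sum_eq mod_mult_left_eq)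
  also have "(\<Sum>j<N. expsum l (f (gen j)) mod 3 * expsum j (g (gen i)) mod 3) =
      (\<Sum>j<N. if j = l then expsum l (g (gen i)) mod 3 else 0)"
    using triv l by (intro sum.cong refl) (auto simp: acts_trivially_mod_3_def)
  also have "\<dots> mod 3 = expsum l (g (gen i)) mod 3" using l by simp
  finally show "expsum l (g [(i, False)]) mod 3 = (if i = l then 1 else 0)" by (auto split: if_splits)
qed

theorem aut_conj_of_power_conj:
  fixes f g g' :: "fword \<Rightarrow> fword"
  assumes N: "2 \<le> N" and k: "0 < k"
    and hom: "f \<in> hom (free_grp N) (free_grp N)" "g \<in> hom (free_grp N) (free_grp N)"
      "g' \<in> hom (free_grp N) (free_grp N)"
    and inverse: "\<And>x. x \<in> carrier (free_grp N) \<Longrightarrow> g (g' x) = x"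
    and triv: "acts_trivially_mod_3 N f" "acts_trivially_mod_3 N g"
    and h: "h \<in> carrier (free_grp N)"
      "\<And>x. x \<in> carrier (free_grp N) \<Longrightarrow>
        (f ^^ k) ((g' ^^ k) x) = h \<otimes>\<^bsub>free_grp N\<^esub> x \<otimes>\<^bsub>free_grp N\<^esub> inv\<^bsub>free_grp N\<^esub> h"
  shows "\<exists>z\<in>carrier (free_grp N). \<forall>x\<in>carrier (free_grp N).
    f (g' x) = z \<otimes>\<^bsub>free_grp N\<^esub> x \<otimes>\<^bsub>free_grp N\<^esub> inv\<^bsub>free_grp N\<^esub> z"
proof -
  interpret grp: group "free_grp N" by (rule group_free_grp)
  interpret F: substitution_mod_3 N "aut_series f"
    by (rule substitution_mod_3_aut_series[OF hom(1) triv(1)])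
  interpret G: substitution_mod_3 N "aut_series g'"
    by (rule substitution_mod_3_aut_series[OF hom(3) acts_trivially_inverse[OF hom(2,3) inverse triv(2)]])
  interpret twisted_pair N "aut_series f" "aut_series g'" ..
  have pow_mem: "(a ^^ n) w \<in> carrier (free_grp N)"
    if "a \<in> hom (free_grp N) (free_grp N)" "w \<in> carrier (free_grp N)" for a n w
    using that by (induction n) (auto intro: hom_carrier_mem)
  have F_pow: "(F ^^ n) (magnus w) = magnus ((f ^^ n) w)" if "w \<in> carrier (free_grp N)" for n w
    using that by (induction n) (simp_all add: subst_aut_series_magnus[OF hom(1)] pow_mem[OF hom(1)])
  have G_pow: "(G ^^ n) (magnus w) = magnus ((g' ^^ n) w)" if "w \<in> carrier (free_grp N)" for n w
    using that by (induction n) (simp_all add: subst_aut_series_magnus[OF hom(3)] pow_mem[OF hom(3)])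
  have FG_add: "(F ^^ n) ((G ^^ n) (1 + a)) = 1 + (F ^^ n) ((G ^^ n) a)" for n a
  proof -
    have "(G ^^ n) (1 + a) = 1 + (G ^^ n) a" "(F ^^ n) (1 + a) = 1 + (F ^^ n) a" for a
      by (induction n) simp_all
    then show ?thesis by simp
  qed
  \<comment> \<open>The case n = k carries the hypothesis on h into series; the case n = 1 relates
    the resulting conjugator to f g'.\<close>
  have FG: "1 + (F ^^ n) ((G ^^ n) (ncvar i)) = magnus ((f ^^ n) ((g' ^^ n) (gen i)))" if i: "i < N" for n i
    unfolding FG_add[symmetric] magnus_generator[symmetric]
    by (simp only: F_pow[OF pow_mem[OF hom(3) gen_carrier[OF i]]] G_pow[OF gen_carrier[OF i]])
  have H: "(F ^^ k) ((G ^^ k) (ncvar i)) * magnus h = magnus h * ncvar i" if i: "i < N" for i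
  proof -
    have "(1 + (F ^^ k) ((G ^^ k) (ncvar i))) * magnus h = magnus h * (1 + ncvar i)"
      unfolding FG[OF i] h(2)[OF gen_carrier[OF i]] magnus_mult magnus_generator
      using magnus_inv_free_grp(2)[OF h(1)] by (simp add: mult.assoc)
    then show ?thesis by (simp add: distrib_left distrib_right)
  qed
  obtain u where u: "coef u [] = 1" "\<And>i. i < N \<Longrightarrow> F (G (ncvar i)) * u = u * ncvar i"
    using conj_of_conj_power[OF N k coef_magnus_Nil H] by blast
  have FG1: "magnus (f (g' (gen i))) = 1 + F (G (ncvar i))" if "i < N" for i
    using FG[OF that, of 1] by simp
  have "\<exists>z. letters_below N z \<and> magnus z = u"
  proof (rule conj_series_is_word[OF N _ u(1)])
    fix i assume i: "i < N"
    show "letters_below N (f (g' (gen i)))"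
      using hom_carrier_mem[OF hom(1) hom_carrier_mem[OF hom(3) gen_carrier[OF i]]]
      by (simp add: carrier_free_grp)
    show "magnus (f (g' (gen i))) * u = u * (1 + ncvar i)"
      unfolding FG1[OF i] using u(2)[OF i] by (simp add: distrib_left distrib_right)
  qed
  then obtain z' where z': "letters_below N z'" "magnus z' = u" by blast
  define z where "z = fw_reduce z'"
  have z: "z \<in> carrier (free_grp N)" "magnus z = u"
    using z' by (simp_all add: z_def reduce_in_carrier)
  show ?thesis
  proof (intro bexI[OF _ z(1)] ballI)
    fix x assume x: "x \<in> carrier (free_grp N)"
    interpret FG: substitution N "\<lambda>i. F (aut_series g' i)"
      by unfold_locales (rule F.subst_idl[OF G.y])
    \<comment> \<open>Conjugacy is known on the variables only; intertwining extends it to the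
      images of all words.\<close>
    have "subst N (\<lambda>i. F (aut_series g' i)) (magnus x) * u - u * subst N ncvar (magnus x) \<in> idl n" for n
      by (rule FG.subst_intertwine[OF ncvar_subst.substitution_axioms]) (use u(2) in simp)
    then have "subst N (\<lambda>i. F (aut_series g' i)) (magnus x) * u = u * magnus x"
      using idl_all_eq magnus_supported x unfolding carrier_free_grp by metis
    also have "subst N (\<lambda>i. F (aut_series g' i)) (magnus x) = F (G (magnus x))"
      by (rule F.subst_comp[OF G.substitution_axioms, symmetric])
    also have "\<dots> = magnus (f (g' x))"
      using F_pow[OF hom_carrier_mem[OF hom(3) x], of 1] G_pow[OF x, of 1] by simp
    finally have conj: "magnus (f (g' x)) * magnus z = magnus z * magnus x" by (simp add: z(2))
    have "magnus (f (g' x)) = magnus z * magnus x * magnus (inv\<^bsub>free_grp N\<^esub> z)"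
      unfolding conj[symmetric] using magnus_inv_free_grp(1)[OF z(1)] by (simp add: mult.assoc)
    then have "magnus (f (g' x)) = magnus (z \<otimes>\<^bsub>free_grp N\<^esub> x \<otimes>\<^bsub>free_grp N\<^esub> inv\<^bsub>free_grp N\<^esub> z)"
      by (simp add: magnus_mult)
    then show "f (g' x) = z \<otimes>\<^bsub>free_grp N\<^esub> x \<otimes>\<^bsub>free_grp N\<^esub> inv\<^bsub>free_grp N\<^esub> z"
      by (rule magnus_inj[rotated 2])
        (use x z(1) hom_carrier_mem[OF hom(1) hom_carrier_mem[OF hom(3) x]] in auto)
  qed
qed

section \<open>Outer automorphisms\<close>

definition inner_aut :: "nat \<Rightarrow> fword \<Rightarrow> fword \<Rightarrow> fword" where
  "inner_aut N g = (\<lambda>h \<in> carrier (free_grp N).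
     g \<otimes>\<^bsub>free_grp N\<^esub> h \<otimes>\<^bsub>free_grp N\<^esub> inv\<^bsub>free_grp N\<^esub> g)"

lemma Inn_free_altdef: "Inn_free N = inner_aut N ` carrier (free_grp N)"
  by (simp add: Inn_free_def inner_aut_def)

lemma group_AutoGroup_free: "group (AutoGroup (free_grp N))"
  by (rule group.AutoGroup[OF group_free_grp])

lemma carrier_AutoGroup: "carrier (AutoGroup G) = auto G"
  by (simp add: AutoGroup_def)

lemma auto_mem: "f \<in> auto G \<Longrightarrow> x \<in> carrier G \<Longrightarrow> f x \<in> carrier G"
  by (auto simp: auto_def intro: hom_carrier_mem)

lemma mult_AutoGroup:
  assumes "f \<in> auto G" "g \<in> auto G" "x \<in> carrier G"
  shows "(f \<otimes>\<^bsub>AutoGroup G\<^esub> g) x = f (g x)"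
  using assms by (simp add: AutoGroup_def BijGroup_def auto_def compose_def)

lemma one_AutoGroup: "x \<in> carrier G \<Longrightarrow> \<one>\<^bsub>AutoGroup G\<^esub> x = x"
  by (simp add: AutoGroup_def BijGroup_def)

lemma auto_eqI:
  assumes "f \<in> auto G" "g \<in> auto G" "\<And>x. x \<in> carrier G \<Longrightarrow> f x = g x"
  shows "f = g"
  using assms by (auto simp: auto_def Bij_def intro: extensionalityI)

lemma inner_aut_apply:
  "x \<in> carrier (free_grp N) \<Longrightarrow>
    inner_aut N h x = h \<otimes>\<^bsub>free_grp N\<^esub> x \<otimes>\<^bsub>free_grp N\<^esub> inv\<^bsub>free_grp N\<^esub> h"
  by (simp add: inner_aut_def)

lemma inner_aut_auto:
  assumes h: "h \<in> carrier (free_grp N)" shows "inner_aut N h \<in> auto (free_grp N)"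
proof -
  interpret group "free_grp N" by (rule group_free_grp)
  have hom: "inner_aut N h \<in> hom (free_grp N) (free_grp N)"
  proof (rule homI)
    fix x y assume xy: "x \<in> carrier (free_grp N)" "y \<in> carrier (free_grp N)"
    show "inner_aut N h x \<in> carrier (free_grp N)" using h xy by (simp add: inner_aut_apply)
    have "h \<otimes>\<^bsub>free_grp N\<^esub> x \<otimes>\<^bsub>free_grp N\<^esub> inv\<^bsub>free_grp N\<^esub> h \<otimes>\<^bsub>free_grp N\<^esub>
        (h \<otimes>\<^bsub>free_grp N\<^esub> y \<otimes>\<^bsub>free_grp N\<^esub> inv\<^bsub>free_grp N\<^esub> h)
      = h \<otimes>\<^bsub>free_grp N\<^esub> (x \<otimes>\<^bsub>free_grp N\<^esub> (inv\<^bsub>free_grp N\<^esub> h \<otimes>\<^bsub>free_grp N\<^esub>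
        (h \<otimes>\<^bsub>free_grp N\<^esub> y))) \<otimes>\<^bsub>free_grp N\<^esub> inv\<^bsub>free_grp N\<^esub> h"
      using h xy by (simp add: m_assoc)
    then show "inner_aut N h (x \<otimes>\<^bsub>free_grp N\<^esub> y) = inner_aut N h x \<otimes>\<^bsub>free_grp N\<^esub> inner_aut N h y"
      using h xy by (simp add: inner_aut_apply inv_solve_left' m_assoc[symmetric])
  qed
  have cancel: "h \<otimes>\<^bsub>free_grp N\<^esub> (inv\<^bsub>free_grp N\<^esub> h \<otimes>\<^bsub>free_grp N\<^esub> a) = a"
    if "a \<in> carrier (free_grp N)" for a
    using h that by (simp add: m_assoc[symmetric])
  have "bij_betw (inner_aut N h) (carrier (free_grp N)) (carrier (free_grp N))"
    by (rule bij_betw_byWitness[where f' = "inner_aut N (inv\<^bsub>free_grp N\<^esub> h)"])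
      (use h cancel in \<open>auto simp: inner_aut_apply m_assoc inv_solve_left' inv_solve_right'\<close>)
  then show ?thesis using hom by (simp add: auto_def Bij_def inner_aut_def)
qed

lemma inner_aut_hom: "group_hom (free_grp N) (AutoGroup (free_grp N)) (inner_aut N)"
proof -
  interpret group "free_grp N" by (rule group_free_grp)
  interpret A: group "AutoGroup (free_grp N)" by (rule group_AutoGroup_free)
  show ?thesis
  proof
    show "inner_aut N \<in> hom (free_grp N) (AutoGroup (free_grp N))"
    proof (rule homI)
      fix g h assume gh: "g \<in> carrier (free_grp N)" "h \<in> carrier (free_grp N)"
      show "inner_aut N g \<in> carrier (AutoGroup (free_grp N))"
        using gh by (simp add: carrier_AutoGroup inner_aut_auto)
      show "inner_aut N (g \<otimes>\<^bsub>free_grp N\<^esub> h) =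
          inner_aut N g \<otimes>\<^bsub>AutoGroup (free_grp N)\<^esub> inner_aut N h"
      proof (rule auto_eqI[where G = "free_grp N"])
        show "inner_aut N g \<otimes>\<^bsub>AutoGroup (free_grp N)\<^esub> inner_aut N h \<in> auto (free_grp N)"
          using gh A.m_closed by (simp add: carrier_AutoGroup inner_aut_auto)
      qed (use gh in \<open>simp_all add: inner_aut_auto mult_AutoGroup inner_aut_apply m_assoc inv_mult_group\<close>)
    qed
  qed
qed

lemma normal_Inn_free: "Inn_free N \<lhd> AutoGroup (free_grp N)"
proof -
  interpret group "free_grp N" by (rule group_free_grp)
  interpret A: group "AutoGroup (free_grp N)" by (rule group_AutoGroup_free)
  interpret inn: group_hom "free_grp N" "AutoGroup (free_grp N)" "inner_aut N" by (rule inner_aut_hom)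
  show ?thesis
    unfolding A.normal_inv_iff
  proof (intro conjI ballI)
    show "subgroup (Inn_free N) (AutoGroup (free_grp N))"
      unfolding Inn_free_altdef by (rule inn.img_is_subgroup)
    fix f i assume f: "f \<in> carrier (AutoGroup (free_grp N))" and "i \<in> Inn_free N"
    then obtain h where h: "h \<in> carrier (free_grp N)" "i = inner_aut N h" by (auto simp: Inn_free_altdef)
    have fa: "f \<in> auto (free_grp N)" using f by (simp add: carrier_AutoGroup)
    then interpret f: group_hom "free_grp N" "free_grp N" f
      by unfold_locales (simp add: auto_def)
    have fh: "f h \<in> carrier (free_grp N)" using h by simp
    have "f \<otimes>\<^bsub>AutoGroup (free_grp N)\<^esub> i = inner_aut N (f h) \<otimes>\<^bsub>AutoGroup (free_grp N)\<^esub> f"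
    proof (rule auto_eqI[where G = "free_grp N"])
      show "f \<otimes>\<^bsub>AutoGroup (free_grp N)\<^esub> i \<in> auto (free_grp N)"
        "inner_aut N (f h) \<otimes>\<^bsub>AutoGroup (free_grp N)\<^esub> f \<in> auto (free_grp N)"
        using f h fh A.m_closed inner_aut_auto by (simp_all add: carrier_AutoGroup)
    qed (use fa h fh in \<open>simp_all add: mult_AutoGroup inner_aut_auto inner_aut_apply\<close>)
    then have "f \<otimes>\<^bsub>AutoGroup (free_grp N)\<^esub> i \<otimes>\<^bsub>AutoGroup (free_grp N)\<^esub> inv\<^bsub>AutoGroup (free_grp N)\<^esub> f =
        inner_aut N (f h)"
      using f A.m_assoc[of "inner_aut N (f h)" f "inv\<^bsub>AutoGroup (free_grp N)\<^esub> f"] inn.hom_closed[OF fh]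
      by simp
    then show "f \<otimes>\<^bsub>AutoGroup (free_grp N)\<^esub> i \<otimes>\<^bsub>AutoGroup (free_grp N)\<^esub> inv\<^bsub>AutoGroup (free_grp N)\<^esub> f \<in> Inn_free N"
      using fh by (simp add: Inn_free_altdef)
  qed
qed

lemma pow_AutoGroup_apply:
  assumes f: "f \<in> auto (free_grp N)" and x: "x \<in> carrier (free_grp N)"
  shows "(f [^]\<^bsub>AutoGroup (free_grp N)\<^esub> (k::nat)) x = (f ^^ k) x"
proof -
  interpret A: group "AutoGroup (free_grp N)" by (rule group_AutoGroup_free)
  show ?thesis using x
  proof (induction k arbitrary: x)
    case 0
    then show ?case by (simp add: one_AutoGroup)
  next
    case (Suc k)
    have "f [^]\<^bsub>AutoGroup (free_grp N)\<^esub> k \<in> auto (free_grp N)"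
      using A.nat_pow_closed[of f k] f by (simp add: carrier_AutoGroup)
    then have "(f [^]\<^bsub>AutoGroup (free_grp N)\<^esub> Suc k) x = (f [^]\<^bsub>AutoGroup (free_grp N)\<^esub> k) (f x)"
      using f Suc.prems by (simp add: mult_AutoGroup)
    then show ?case using Suc.IH[OF auto_mem[OF f Suc.prems]] by (simp add: funpow_swap1)
  qed
qed

theorem theorem1p1:
  fixes N :: nat and \<phi> \<psi> :: "(fword \<Rightarrow> fword) set" and k :: nat
  assumes "N \<ge> 2"
    and "\<phi> \<in> IA3 N" and "\<psi> \<in> IA3 N"
    and "k \<ge> 1"
    and "\<phi> [^]\<^bsub>Out_free N\<^esub> k = \<psi> [^]\<^bsub>Out_free N\<^esub> k"
  shows "\<phi> = \<psi>"
proof -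
  let ?F = "free_grp N" and ?A = "AutoGroup (free_grp N)" and ?I = "Inn_free N"
  interpret A: group ?A by (rule group_AutoGroup_free)
  interpret I: normal ?I ?A by (rule normal_Inn_free)
  have repr: "\<exists>f\<in>auto ?F. \<chi> = ?I #>\<^bsub>?A\<^esub> f \<and> acts_trivially_mod_3 N f" if chi: "\<chi> \<in> IA3 N" for \<chi>
  proof -
    obtain f where f: "f \<in> auto ?F" "\<chi> = ?I #>\<^bsub>?A\<^esub> f"
      using chi by (auto simp: IA3_def Out_free_def carrier_FactGroup carrier_AutoGroup)
    have "f \<in> \<chi>" using f A.rcos_self[OF _ I.subgroup_axioms] by (simp add: carrier_AutoGroup)
    then have "acts_trivially_mod_3 N f" using chi by (auto simp: IA3_def acts_trivially_mod_3_def)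
    then show ?thesis using f by blast
  qed
  obtain f where f: "f \<in> auto ?F" "\<phi> = ?I #>\<^bsub>?A\<^esub> f" "acts_trivially_mod_3 N f"
    using repr[OF assms(2)] by blast
  obtain g where g: "g \<in> auto ?F" "\<psi> = ?I #>\<^bsub>?A\<^esub> g" "acts_trivially_mod_3 N g"
    using repr[OF assms(3)] by blast
  have fA: "f \<in> carrier ?A" and gA: "g \<in> carrier ?A" using f g by (simp_all add: carrier_AutoGroup)
  define g' where "g' = inv\<^bsub>?A\<^esub> g"
  have g'A: "g' \<in> carrier ?A" using gA by (simp add: g'_def)
  then have g': "g' \<in> auto ?F" by (simp add: carrier_AutoGroup)
  \<comment> \<open>Powers of cosets are computed on representatives, so f^k and g^k differ by an
    inner automorphism.\<close>
  have "?I #>\<^bsub>?A\<^esub> (f [^]\<^bsub>?A\<^esub> k) = ?I #>\<^bsub>?A\<^esub> (g [^]\<^bsub>?A\<^esub> k)"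
    using assms(5) fA gA unfolding f(2) g(2) Out_free_def by (simp add: I.FactGroup_pow)
  then have "f [^]\<^bsub>?A\<^esub> k \<in> ?I #>\<^bsub>?A\<^esub> (g [^]\<^bsub>?A\<^esub> k)"
    using A.rcos_self[OF _ I.subgroup_axioms, of "f [^]\<^bsub>?A\<^esub> k"] fA by simp
  then obtain h where h: "h \<in> carrier ?F" "f [^]\<^bsub>?A\<^esub> k = inner_aut N h \<otimes>\<^bsub>?A\<^esub> g [^]\<^bsub>?A\<^esub> k"
    by (auto simp: r_coset_def Inn_free_altdef)
  have iA: "inner_aut N z \<in> carrier ?A" if "z \<in> carrier ?F" for z
    using inner_aut_auto[OF that] by (simp add: carrier_AutoGroup)
  have "f [^]\<^bsub>?A\<^esub> k \<otimes>\<^bsub>?A\<^esub> g' [^]\<^bsub>?A\<^esub> k = inner_aut N h"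
    unfolding h(2) g'_def using iA[OF h(1)] gA by (simp add: A.nat_pow_inv A.m_assoc)
  moreover have "(f [^]\<^bsub>?A\<^esub> k \<otimes>\<^bsub>?A\<^esub> g' [^]\<^bsub>?A\<^esub> k) x = (f ^^ k) ((g' ^^ k) x)" if x: "x \<in> carrier ?F" for x
  proof -
    have pows: "f [^]\<^bsub>?A\<^esub> k \<in> auto ?F" "g' [^]\<^bsub>?A\<^esub> k \<in> auto ?F"
      using fA g'A A.nat_pow_closed by (simp_all add: carrier_AutoGroup[symmetric])
    show ?thesis
      unfolding mult_AutoGroup[OF pows x] pow_AutoGroup_apply[OF f(1) auto_mem[OF pows(2) x]]
      unfolding pow_AutoGroup_apply[OF g' x] ..
  qed
  ultimately have pow: "(f ^^ k) ((g' ^^ k) x) = h \<otimes>\<^bsub>?F\<^esub> x \<otimes>\<^bsub>?F\<^esub> inv\<^bsub>?F\<^esub> h" if "x \<in> carrier ?F" for x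
    using that inner_aut_apply by metis
  have inverse: "g (g' x) = x" if "x \<in> carrier ?F" for x
    using mult_AutoGroup[OF g(1) g' that] A.r_inv[OF gA] one_AutoGroup[OF that] by (simp add: g'_def)
  have homs: "f \<in> hom ?F ?F" "g \<in> hom ?F ?F" "g' \<in> hom ?F ?F" using f g g' by (simp_all add: auto_def)
  obtain z where z: "z \<in> carrier ?F"
    "\<And>x. x \<in> carrier ?F \<Longrightarrow> f (g' x) = z \<otimes>\<^bsub>?F\<^esub> x \<otimes>\<^bsub>?F\<^esub> inv\<^bsub>?F\<^esub> z"
    using aut_conj_of_power_conj[OF assms(1) _ homs inverse f(3) g(3) h(1) pow] assms(4) by auto
  have "f \<otimes>\<^bsub>?A\<^esub> g' = inner_aut N z"
  proof (rule auto_eqI[where G = ?F])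
    show "f \<otimes>\<^bsub>?A\<^esub> g' \<in> auto ?F" using A.m_closed[OF fA g'A] by (simp add: carrier_AutoGroup)
  qed (use z f g' in \<open>simp_all add: inner_aut_auto mult_AutoGroup inner_aut_apply\<close>)
  then have "f = inner_aut N z \<otimes>\<^bsub>?A\<^esub> g"
    using fA gA by (metis A.inv_solve_right g'_def A.m_closed g'A)
  then have "f \<in> ?I #>\<^bsub>?A\<^esub> g" using z(1) by (auto simp: r_coset_def Inn_free_altdef)
  then show ?thesis
    unfolding f(2) g(2) using A.repr_independence[OF _ gA I.subgroup_axioms] by simp
qed

end
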